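(* Let $m$ be a string on $\mathbb{R}$ of infinite length with associated measure $\mu_m$, and let $A:D(A)\to X$ be a closed, accretive linear operator on a Banach space $X$. Then for every $f\in X$ there is at most one weak solution $u\in L^\infty([0,\infty);X)$ of the Dirichlet problem $$Au(z)-\tfrac12\frac{\mathrm d}{\mathrm dm}\frac{\mathrm d u}{\mathrm dz}(z)=0\quad\text{for } z\in(0,\infty),\qquad u(0)=f.$$
   Context: **Strings.** A string on $\mathbb{R}$ of infinite length is a non-decreasing, right-continuous function $m:\mathbb{R}\to[0,\infty)$ such that (i) $m(x)=0$ for all $x<0$ and $m(0-)=0$, (ii) $m(x_0)<\infty$ for some $x_0\ge 0$, (iii) $m(x)>0$ for all $x>0$. Its associated measure $\mu_m$ is the unique Radon measure on $\mathbb{R}$ with $\mu_m((a,b])=m(b+)-m(a+)$ for all $a<b$. **Accretive.** With $J(x)=\{x'\in X':\langle x',x\rangle=\|x\|^2=\|x'\|^2\}$, a linear operator $A$ is accretive if for every $u\in D(A)$ there is $x'\in J(u)$ with $\mathrm{Re}\langle x',Au\rangle\ge0$. **Weak $m$-derivative.** For $v\in L^1_{loc}((0,\infty);X)$, a function $g\in L^1_{loc,\mu_m}((0,\infty);X)$ (locally Bochner integrable with respect to $\mu_m$) is the weak $m$-derivative $\frac{\mathrm dv}{\mathrm dm}$ of $v$ if $\int_0^\infty g\,\xi\,\mathrm d\mu_m=-\int_0^\infty v\,\xi'\,\mathrm dz$ for every $\xi\in C_c^\infty((0,\infty))$. **Weak solution.** For $f\in X$, a weak solution of the Dirichlet problem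 is a function $u\in C([0,\infty);X)$ with $u(0)=f$ such that $u$ and its weak derivative $\frac{\mathrm du}{\mathrm dz}$ belong to $L^1_{loc}([0,\infty);X)$, $\frac{\mathrm du}{\mathrm dz}$ has a weak $m$-derivative $\frac{\mathrm d}{\mathrm dm}\frac{\mathrm du}{\mathrm dz}\in L^1_{loc,\mu_m}([0,\infty);X)$, and for $\mu_m$-a.e. $z\in(0,\infty)$ one has $u(z)\in D(A)$ and $Au(z)=\frac12\frac{\mathrm d}{\mathrm dm}\frac{\mathrm du}{\mathrm dz}(z)$. Here $L^1_{loc}([0,\infty);X)$, $L^1_{loc,\mu_m}([0,\infty);X)$ mean integrable over each compact subset of $[0,\infty)$. *)

theory Defs
  imports "HOL-Analysis.Analysis"
begin

section \<open>Banach spaces over the real or complex numbers\<close>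

text \<open>
  The scalar field is a type of sort real_normed_field and real_inner. The types real and complex
  are both instances. Since the norm is multiplicative, a field of this sort is isometrically
  isomorphic to one of the two (Ostrowski), and the inner product with 1 is the real part.
\<close>

definition re_part :: "'k::{real_normed_field,real_inner} \<Rightarrow> real" where
  "re_part z = inner z 1"

lemma re_part_complex: "re_part z = Re z"
  by (simp add: re_part_def)

lemma re_part_real: "re_part r = r" for r :: real
  by (simp add: re_part_def)

text \<open>The type class banach only supplies real scalars, the norm and completeness.\<close>

locale banach_space_over = vector_space smul
  for smul :: "'k::{real_normed_field,real_inner} \<Rightarrow> 'a::banach \<Rightarrow> 'a" +
  assumes scale_of_real: "smul (of_real r) x = r *\<^sub>R x"
    and norm_scale: "norm (smul c x) = norm c * norm x"

definition dual_space ::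
    "('k::{real_normed_field,real_inner} \<Rightarrow> 'a::banach \<Rightarrow> 'a) \<Rightarrow> ('a \<Rightarrow> 'k) set" where
  "dual_space smul = {x'. Vector_Spaces.linear smul (*) x' \<and> bounded_linear x'}"

definition duality_map ::
    "('k::{real_normed_field,real_inner} \<Rightarrow> 'a::banach \<Rightarrow> 'a) \<Rightarrow> 'a \<Rightarrow> ('a \<Rightarrow> 'k) set" where
  "duality_map smul x =
     {x' \<in> dual_space smul. x' x = of_real ((norm x)\<^sup>2) \<and> (norm x)\<^sup>2 = (onorm x')\<^sup>2}"


section \<open>Unbounded operators\<close>

text \<open>An operator is a domain \<open>D\<close> together with a total function \<open>A\<close>, of which only the values
  on \<open>D\<close> are relevant.\<close>

definition linear_operator ::
    "('k::{real_normed_field,real_inner} \<Rightarrow> 'a::banach \<Rightarrow> 'a) \<Rightarrow> 'a set \<Rightarrow> ('a \<Rightarrow> 'a) \<Rightarrow> bool" where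
  "linear_operator smul D A \<longleftrightarrow>
     module.subspace smul D \<and>
     (\<forall>x\<in>D. \<forall>y\<in>D. A (x + y) = A x + A y) \<and>
     (\<forall>c. \<forall>x\<in>D. A (smul c x) = smul c (A x))"

definition closed_operator :: "'a::banach set \<Rightarrow> ('a \<Rightarrow> 'a) \<Rightarrow> bool" where
  "closed_operator D A \<longleftrightarrow> closed ((\<lambda>x. (x, A x)) ` D)"

definition accretive ::
    "('k::{real_normed_field,real_inner} \<Rightarrow> 'a::banach \<Rightarrow> 'a) \<Rightarrow> 'a set \<Rightarrow> ('a \<Rightarrow> 'a) \<Rightarrow> bool" where
  "accretive smul D A \<longleftrightarrow> (\<forall>x\<in>D. \<exists>x'\<in>duality_map smul x. re_part (x' (A x)) \<ge> 0)"


section \<open>Strings\<close>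

text \<open>Infinite length means that the string is finite everywhere, so \<open>m\<close> is real-valued; the
  requirement \<open>m x0 < \<infinity>\<close> for some \<open>x0 \<ge> 0\<close> is then part of the type.\<close>

definition infinite_string :: "(real \<Rightarrow> real) \<Rightarrow> bool" where
  "infinite_string m \<longleftrightarrow>
     mono m \<and> (\<forall>x. continuous (at_right x) m) \<and> (\<forall>x. m x \<ge> 0) \<and>
     (\<forall>x<0. m x = 0) \<and> (m \<longlongrightarrow> 0) (at_left 0) \<and>
     (\<forall>x>0. m x > 0)"

text \<open>Completed, so that Borel measurability of a vector-valued function does not depend on its
  values on a null set.\<close>

definition string_measure :: "(real \<Rightarrow> real) \<Rightarrow> real measure" where
  "string_measure m = completion (interval_measure m)"

lemma emeasure_string_measure_Ioc:
  assumes "infinite_string m" and "a \<le> b"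
  shows "emeasure (string_measure m) {a<..b} = ennreal (m b - m a)"
  using assms emeasure_interval_measure_Ioc[of a b m]
  by (simp add: string_measure_def infinite_string_def mono_def)


section \<open>Bochner integral\<close>

text \<open>The library's Bochner integral is restricted to second countable (that is, separable) target
  spaces. The following is the same definition without this restriction; the approximation by
  simple functions provides strong measurability.\<close>

definition has_bochner ::
    "'s measure \<Rightarrow> ('s \<Rightarrow> 'a::real_normed_vector) \<Rightarrow> 'a \<Rightarrow> bool" where
  "has_bochner M f x \<longleftrightarrow>
     f \<in> borel_measurable M \<and>
     (\<exists>s. (\<forall>i. Bochner_Integration.simple_bochner_integrable M (s i)) \<and>
          (\<lambda>i. \<integral>\<^sup>+ t. ennreal (norm (f t - s i t)) \<partial>M) \<longlonglongrightarrow> 0 \<and>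
          (\<lambda>i. Bochner_Integration.simple_bochner_integral M (s i)) \<longlonglongrightarrow> x)"

lemma has_bochner_eq_has_bochner_integral:
  fixes f :: "'s \<Rightarrow> 'a::{real_normed_vector, second_countable_topology}"
  shows "has_bochner M f x \<longleftrightarrow> has_bochner_integral M f x"
  unfolding has_bochner_def has_bochner_integral.simps by auto

definition locally_integrable ::
    "real measure \<Rightarrow> real set \<Rightarrow> (real \<Rightarrow> 'a::banach) \<Rightarrow> bool" where
  "locally_integrable M I f \<longleftrightarrow>
     (\<forall>K. compact K \<and> K \<subseteq> I \<longrightarrow> (\<exists>x. has_bochner M (\<lambda>t. indicator K t *\<^sub>R f t) x))"


section \<open>Weak derivatives and weak solutions\<close>

definition test_function :: "(real \<Rightarrow> real) \<Rightarrow> bool" where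
  "test_function \<xi> \<longleftrightarrow>
     (\<forall>k. (deriv ^^ k) \<xi> differentiable_on UNIV) \<and>
     compact (closure {t. \<xi> t \<noteq> 0}) \<and> closure {t. \<xi> t \<noteq> 0} \<subseteq> {0<..}"

text \<open>\<open>g\<close> is the weak derivative of \<open>v\<close> on \<open>(0,\<infinity>)\<close> with respect to the measure \<open>M\<close>; for
  Lebesgue measure this is the usual weak derivative. The number \<open>I\<close> is the common value of
  \<open>\<integral> g \<xi> dM\<close> and \<open>- \<integral> v \<xi>' dz\<close>; both integrals exist by local integrability.\<close>

definition weak_derivative ::
    "real measure \<Rightarrow> (real \<Rightarrow> 'a::banach) \<Rightarrow> (real \<Rightarrow> 'a) \<Rightarrow> bool" where
  "weak_derivative M v g \<longleftrightarrow>
     locally_integrable lebesgue {0<..} v \<and> locally_integrable M {0<..} g \<and>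
     (\<forall>\<xi>. test_function \<xi> \<longrightarrow>
        (\<exists>I. has_bochner M (\<lambda>z. indicator {0<..} z *\<^sub>R \<xi> z *\<^sub>R g z) I \<and>
             has_bochner lebesgue (\<lambda>z. indicator {0<..} z *\<^sub>R deriv \<xi> z *\<^sub>R v z) (- I)))"

text \<open>Functions on \<open>[0,\<infinity>)\<close> are total functions whose values on negative arguments are irrelevant.
  Below, \<open>w\<close> is du/dz and \<open>g\<close> is its weak \<open>m\<close>-derivative.\<close>

definition weak_solution ::
    "(real \<Rightarrow> real) \<Rightarrow> 'a::banach set \<Rightarrow> ('a \<Rightarrow> 'a) \<Rightarrow> 'a \<Rightarrow> (real \<Rightarrow> 'a) \<Rightarrow> bool" where
  "weak_solution m D A f u \<longleftrightarrow>
     continuous_on {0..} u \<and> u 0 = f \<and>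
     (\<exists>w g. locally_integrable lebesgue {0..} u \<and> locally_integrable lebesgue {0..} w \<and>
            weak_derivative lebesgue u w \<and>
            locally_integrable (string_measure m) {0..} g \<and>
            weak_derivative (string_measure m) w g \<and>
            (AE z in string_measure m. z \<in> {0<..} \<longrightarrow> u z \<in> D \<and> A (u z) = (1/2) *\<^sub>R g z))"

text \<open>Membership in \<open>L\<^sup>\<infinity>([0,\<infinity>);X)\<close>: an essentially bounded function is locally integrable if and
  only if it is strongly measurable.\<close>

definition L_infinity :: "(real \<Rightarrow> 'a::banach) \<Rightarrow> bool" where
  "L_infinity u \<longleftrightarrow>
     locally_integrable lebesgue {0..} u \<and>
     (\<exists>C. AE z in lebesgue. z \<in> {0..} \<longrightarrow> norm (u z) \<le> C)"

end

theory Submission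
  imports Defs
begin

text \<open>Let \<open>d\<close> be the difference of two solutions, with \<open>g = d/dm d/dz d\<close>. Testing the two weak
  equations with an approximation of the tent function \<open>t \<mapsto> (h - |t - z|)\<^sup>+\<close> shows that
  \<open>d(z - h) + d(z + h) - 2 d(z)\<close> is the integral of \<open>g\<close> against that tent. Accretivity in the form
  \<open>\<parallel>x\<parallel> \<le> \<parallel>x + l A x\<parallel>\<close> then makes \<open>\<parallel>d\<parallel>\<close> midpoint convex at \<open>z\<close> up to the oscillation of \<open>g\<close> near \<open>z\<close>.
  By a Lusin argument, on \<open>[0,R]\<close> this error is dominated by a function \<open>q\<close> of small integral, and adding
  the potential \<open>\<integral> |z - t| q(t) / 2 dm(t)\<close> restores local midpoint convexity at every point of \<open>(0,R)\<close>.
  Hence \<open>\<parallel>d(a)\<parallel> \<le> \<parallel>d(R)\<parallel> a / R\<close> up to an arbitrarily small error, and \<open>R\<close> tends to infinity.\<close>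

text \<open>Accretivity is available only at almost every point of the string measure, and
  \<open>G\<close> is merely integrable, so its value at a single point means nothing in general.
  The comparison with a chord, however, needs midpoint convexity at every interior point: the
  maximum could sit exactly in the exceptional set. Therefore \<open>G\<close> near \<open>z\<close>
  is replaced by a constant \<open>c\<close> that depends on where \<open>z\<close> lies. On a
  compact set \<open>F\<close> of good points \<open>c = G z\<close>. Elsewhere
  \<open>c = 0\<close>, for which the inequality
  \<open>norm (d z) \<le> norm (d z + l *\<^sub>R c)\<close> is trivial, and the full size of
  \<open>G\<close> is charged to \<open>q\<close>. The parameter \<open>l\<close> is half the
  integral of the tent, so atoms of the measure need no separate treatment: they only make
  \<open>l\<close> larger. The potential is bounded by \<open>R / 2\<close> times the integral of
  \<open>q\<close>; hence \<open>q\<close> is chosen after \<open>R\<close>.\<close>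

section \<open>Bochner integrals in non-separable spaces\<close>

text \<open>Measurability is demanded of the majorants \<open>e i\<close> only: in a non-separable space, sums of Borel
  measurable functions need not be Borel measurable, so \<open>has_bochner\<close> is not obviously additive.\<close>

definition ae_bochner ::
    "'s measure \<Rightarrow> ('s \<Rightarrow> 'a::real_normed_vector) \<Rightarrow> 'a \<Rightarrow> bool" where
  "ae_bochner M f x \<longleftrightarrow>
     (\<exists>s e. (\<forall>i. Bochner_Integration.simple_bochner_integrable M (s i)) \<and>
            (\<forall>i. e i \<in> borel_measurable M) \<and>
            (\<forall>i. AE t in M. ennreal (norm (f t - s i t)) \<le> e i t) \<and>
            (\<lambda>i. \<integral>\<^sup>+ t. e i t \<partial>M) \<longlonglongrightarrow> 0 \<and>
            (\<lambda>i. Bochner_Integration.simple_bochner_integral M (s i)) \<longlonglongrightarrow> x)"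

lemma borel_measurable_norm_diff_const:
  fixes f :: "'s \<Rightarrow> 'a::real_normed_vector"
  assumes "f \<in> borel_measurable M"
  shows "(\<lambda>t. norm (f t - c)) \<in> borel_measurable M"
proof -
  have "(\<lambda>y. norm (y - c)) \<in> borel_measurable borel"
    by (intro borel_measurable_continuous_onI continuous_intros)
  from measurable_compose[OF assms this] show ?thesis .
qed

text \<open>The simple function has finitely many values \<open>y\<close>, and on each of its level
  sets the function equals \<open>norm (f t - y)\<close>, a continuous function of
  \<open>f t\<close> alone. No measurability of a general difference is involved.\<close>

lemma borel_measurable_norm_diff_simple:
  fixes f :: "'s \<Rightarrow> 'a::real_normed_vector"
  assumes f: "f \<in> borel_measurable M" and s: "simple_function M s"
  shows "(\<lambda>t. norm (f t - s t)) \<in> borel_measurable M"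
proof (rule measurable_compose_countable'[where f="\<lambda>y t. norm (f t - y)" and g=s and I="s ` space M"])
  show "s \<in> M \<rightarrow>\<^sub>M count_space (s ` space M)"
    using s by (auto simp: simple_function_def measurable_count_space_eq2)
  show "countable (s ` space M)"
    using s by (auto simp: simple_function_def countable_finite)
qed (rule borel_measurable_norm_diff_const[OF f])

lemma ae_bochner_if_has_bochner:
  assumes "has_bochner M f x" shows "ae_bochner M f x"
proof -
  obtain s where f: "f \<in> borel_measurable M"
    and s: "\<And>i. Bochner_Integration.simple_bochner_integrable M (s i)"
    "(\<lambda>i. \<integral>\<^sup>+ t. ennreal (norm (f t - s i t)) \<partial>M) \<longlonglongrightarrow> 0"
    "(\<lambda>i. Bochner_Integration.simple_bochner_integral M (s i)) \<longlonglongrightarrow> x"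
    using assms unfolding has_bochner_def by blast
  have m: "(\<lambda>t. ennreal (norm (f t - s i t))) \<in> borel_measurable M" for i
    using borel_measurable_norm_diff_simple[OF f, of "s i"] s(1)[of i]
    by (auto elim: Bochner_Integration.simple_bochner_integrable.cases)
  show ?thesis
    unfolding ae_bochner_def
    by (rule exI[of _ s], rule exI[of _ "\<lambda>i t. ennreal (norm (f t - s i t))"]) (use s m in auto)
qed

text \<open>This is what the majorants are for: \<open>e i + e' i\<close> is measurable whatever is
  known about \<open>f - g\<close>.\<close>

lemma ae_bochner_diff:
  assumes "ae_bochner M f x" "ae_bochner M g y"
  shows "ae_bochner M (\<lambda>t. f t - g t) (x - y)"
proof -
  obtain s e where s: "\<And>i. Bochner_Integration.simple_bochner_integrable M (s i)"
    "\<And>i. e i \<in> borel_measurable M" "\<And>i. AE t in M. ennreal (norm (f t - s i t)) \<le> e i t"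
    "(\<lambda>i. \<integral>\<^sup>+ t. e i t \<partial>M) \<longlonglongrightarrow> 0"
    "(\<lambda>i. Bochner_Integration.simple_bochner_integral M (s i)) \<longlonglongrightarrow> x"
    using assms(1) unfolding ae_bochner_def by blast
  obtain s' e' where s': "\<And>i. Bochner_Integration.simple_bochner_integrable M (s' i)"
    "\<And>i. e' i \<in> borel_measurable M" "\<And>i. AE t in M. ennreal (norm (g t - s' i t)) \<le> e' i t"
    "(\<lambda>i. \<integral>\<^sup>+ t. e' i t \<partial>M) \<longlonglongrightarrow> 0"
    "(\<lambda>i. Bochner_Integration.simple_bochner_integral M (s' i)) \<longlonglongrightarrow> y"
    using assms(2) unfolding ae_bochner_def by blast
  have "AE t in M. ennreal (norm (f t - g t - (s i t - s' i t))) \<le> e i t + e' i t" for i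
    using s(3)[of i] s'(3)[of i]
  proof eventually_elim
    case (elim t)
    have "ennreal (norm (f t - g t - (s i t - s' i t))) \<le> ennreal (norm (f t - s i t) + norm (g t - s' i t))"
      using norm_triangle_ineq4[of "f t - s i t" "g t - s' i t"]
      by (intro ennreal_leI) (simp add: algebra_simps)
    then show ?case using add_mono[OF elim] by simp
  qed
  moreover have "(\<lambda>i. \<integral>\<^sup>+ t. e i t + e' i t \<partial>M) \<longlonglongrightarrow> 0"
    using tendsto_add[OF s(4) s'(4)] s(2) s'(2) by (simp add: nn_integral_add)
  moreover have "(\<lambda>i. Bochner_Integration.simple_bochner_integral M (\<lambda>t. s i t - s' i t)) \<longlonglongrightarrow> x - y"
    using tendsto_diff[OF s(5) s'(5)] s(1) s'(1)
    by (simp add: Bochner_Integration.simple_bochner_integral_diff)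
  ultimately show ?thesis
    unfolding ae_bochner_def using s(1,2) s'(1,2)
    by (intro exI[of _ "\<lambda>i t. s i t - s' i t"] exI[of _ "\<lambda>i t. e i t + e' i t"])
      (simp_all add: Bochner_Integration.simple_bochner_integrable_compose2[where p="(-)", OF _ s(1) s'(1)])
qed

text \<open>The simple integrals are bounded by the integral of \<open>e i + q\<close>, and the part
  from \<open>e i\<close> vanishes in the limit. Uniqueness of the integral and all later error
  estimates come from this inequality.\<close>

lemma ae_bochner_norm_le:
  assumes "ae_bochner M f x" and q[measurable]: "q \<in> borel_measurable M"
    and le: "AE t in M. ennreal (norm (f t)) \<le> q t"
  shows "ennreal (norm x) \<le> (\<integral>\<^sup>+ t. q t \<partial>M)"
proof -
  obtain s e where s: "\<And>i. Bochner_Integration.simple_bochner_integrable M (s i)"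
    "\<And>i. e i \<in> borel_measurable M" "\<And>i. AE t in M. ennreal (norm (f t - s i t)) \<le> e i t"
    "(\<lambda>i. \<integral>\<^sup>+ t. e i t \<partial>M) \<longlonglongrightarrow> 0"
    "(\<lambda>i. Bochner_Integration.simple_bochner_integral M (s i)) \<longlonglongrightarrow> x"
    using assms(1) unfolding ae_bochner_def by blast
  note s(2)[measurable]
  have "ennreal (norm (Bochner_Integration.simple_bochner_integral M (s i))) \<le>
      (\<integral>\<^sup>+ t. e i t \<partial>M) + (\<integral>\<^sup>+ t. q t \<partial>M)" for i
  proof -
    have "ennreal (norm (Bochner_Integration.simple_bochner_integral M (s i))) \<le>
        ennreal (Bochner_Integration.simple_bochner_integral M (\<lambda>t. norm (s i t)))"
      by (intro ennreal_leI Bochner_Integration.simple_bochner_integral_norm_bound s)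
    also have "\<dots> = (\<integral>\<^sup>+ t. norm (s i t) \<partial>M)"
      by (intro Bochner_Integration.simple_bochner_integral_eq_nn_integral)
        (simp_all add: Bochner_Integration.simple_bochner_integrable_compose2[OF _ s(1)[of i] s(1)[of i],
             where p="\<lambda>x y. norm x"])
    also have "\<dots> \<le> (\<integral>\<^sup>+ t. e i t + q t \<partial>M)"
      using s(3)[of i] le
    proof (intro nn_integral_mono_AE, eventually_elim)
      case (elim t)
      have "ennreal (norm (s i t)) \<le> ennreal (norm (f t - s i t) + norm (f t))"
        using norm_triangle_ineq4[of "f t" "f t - s i t"] by (intro ennreal_leI) simp
      also have "\<dots> = ennreal (norm (f t - s i t)) + ennreal (norm (f t))" by simp
      also have "\<dots> \<le> e i t + q t" using elim(3,4) by (rule add_mono)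
      finally show ?case .
    qed
    also have "\<dots> = (\<integral>\<^sup>+ t. e i t \<partial>M) + (\<integral>\<^sup>+ t. q t \<partial>M)"
      by (rule nn_integral_add) auto
    finally show ?thesis .
  qed
  moreover have l: "(\<lambda>i. (\<integral>\<^sup>+ t. e i t \<partial>M) + (\<integral>\<^sup>+ t. q t \<partial>M)) \<longlonglongrightarrow> 0 + (\<integral>\<^sup>+ t. q t \<partial>M)"
    by (intro tendsto_intros s)
  moreover have l': "(\<lambda>i. ennreal (norm (Bochner_Integration.simple_bochner_integral M (s i)))) \<longlonglongrightarrow> ennreal (norm x)"
    by (intro tendsto_ennrealI tendsto_norm s)
  ultimately show ?thesis
    using LIMSEQ_le[OF l' l] by simp
qed

lemma ae_bochner_unique:
  assumes "ae_bochner M f x" "ae_bochner M f y" shows "x = y"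
proof -
  have "ennreal (norm (x - y)) \<le> (\<integral>\<^sup>+ t. 0 \<partial>M)"
    by (rule ae_bochner_norm_le[OF ae_bochner_diff[OF assms]]) auto
  then show ?thesis by simp
qed

text \<open>Supplies the comparison integrals, in which a vector-valued function is frozen at a
  constant \<open>c\<close>. The scalar approximations of \<open>\<phi>\<close> are multiplied by
  \<open>c\<close>.\<close>

lemma ae_bochner_scaleR_const:
  fixes \<phi> :: "'s \<Rightarrow> real"
  assumes "integrable M \<phi>"
  shows "ae_bochner M (\<lambda>t. \<phi> t *\<^sub>R c) ((\<integral>t. \<phi> t \<partial>M) *\<^sub>R c)"
proof -
  have "has_bochner_integral M \<phi> (\<integral>t. \<phi> t \<partial>M)"
    using assms by (rule has_bochner_integral_integrable)
  then obtain s where m[measurable]: "\<phi> \<in> borel_measurable M"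
    and s: "\<And>i. Bochner_Integration.simple_bochner_integrable M (s i)"
    "(\<lambda>i. \<integral>\<^sup>+ t. norm (\<phi> t - s i t) \<partial>M) \<longlonglongrightarrow> 0"
    "(\<lambda>i. Bochner_Integration.simple_bochner_integral M (s i)) \<longlonglongrightarrow> (\<integral>t. \<phi> t \<partial>M)"
    unfolding has_bochner_integral.simps by blast
  have [measurable]: "s i \<in> borel_measurable M" for i
    using s(1)[of i] by (auto elim: Bochner_Integration.simple_bochner_integrable.cases
        intro: borel_measurable_simple_function)
  have lin: "linear (\<lambda>r::real. r *\<^sub>R c)" by (simp add: linear_iff scaleR_left.add)
  have "(\<integral>\<^sup>+ t. ennreal (norm (\<phi> t - s i t)) * ennreal (norm c) \<partial>M)
      = (\<integral>\<^sup>+ t. norm (\<phi> t - s i t) \<partial>M) * ennreal (norm c)" for i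
    by (rule nn_integral_multc) measurable
  moreover have "(\<lambda>i. (\<integral>\<^sup>+ t. norm (\<phi> t - s i t) \<partial>M) * ennreal (norm c)) \<longlonglongrightarrow> 0 * ennreal (norm c)"
    by (rule tendsto_mult_ennreal[OF s(2)]) auto
  moreover have "(\<lambda>i. Bochner_Integration.simple_bochner_integral M (\<lambda>t. s i t *\<^sub>R c)) \<longlonglongrightarrow> (\<integral>t. \<phi> t \<partial>M) *\<^sub>R c"
    using tendsto_scaleR[OF s(3) tendsto_const[of c]] s(1)
    by (simp add: Bochner_Integration.simple_bochner_integral_linear[OF lin])
  moreover have "ennreal (norm (\<phi> t *\<^sub>R c - s i t *\<^sub>R c)) \<le> ennreal (norm (\<phi> t - s i t)) * ennreal (norm c)" for i t
    by (simp add: scaleR_left_diff_distrib[symmetric] ennreal_mult)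
  ultimately show ?thesis
    unfolding ae_bochner_def using s(1)
    by (intro exI[of _ "\<lambda>i t. s i t *\<^sub>R c"]
        exI[of _ "\<lambda>i t. ennreal (norm (\<phi> t - s i t)) * ennreal (norm c)"])
      (simp_all add: Bochner_Integration.simple_bochner_integrable_compose2[where p="\<lambda>x y. x *\<^sub>R c", OF _ s(1) s(1)])
qed

lemma ae_bochner_uminus:
  assumes "ae_bochner M f x"
  shows "ae_bochner M (\<lambda>t. - f t) (- x)"
  using ae_bochner_diff[OF ae_bochner_diff[OF assms assms] assms] by simp

lemma ae_bochner_add:
  assumes "ae_bochner M f x" "ae_bochner M g y"
  shows "ae_bochner M (\<lambda>t. f t + g t) (x + y)"
  using ae_bochner_diff[OF assms(1) ae_bochner_uminus[OF assms(2)]] by simp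

text \<open>One simple function at distance less than 1 suffices, because its own norm has finite
  integral.\<close>

lemma has_bochner_nn_integral_finite:
  assumes "has_bochner M f x"
  shows "(\<integral>\<^sup>+ t. ennreal (norm (f t)) \<partial>M) < \<infinity>"
proof -
  obtain s where f: "f \<in> borel_measurable M"
    and s: "\<And>i. Bochner_Integration.simple_bochner_integrable M (s i)"
    "(\<lambda>i. \<integral>\<^sup>+ t. ennreal (norm (f t - s i t)) \<partial>M) \<longlonglongrightarrow> 0"
    using assms unfolding has_bochner_def by blast
  have sf: "simple_function M (s i)" for i
    using s(1)[of i] by (auto elim: Bochner_Integration.simple_bochner_integrable.cases)
  have m[measurable]: "(\<lambda>t. norm (f t - s i t)) \<in> borel_measurable M" for i
    using borel_measurable_norm_diff_simple[OF f sf] .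
  have [measurable]: "(\<lambda>t. norm (s i t)) \<in> borel_measurable M" for i
    using borel_measurable_simple_function[OF simple_function_compose1[OF sf, of norm]] .
  have "eventually (\<lambda>i. (\<integral>\<^sup>+ t. ennreal (norm (f t - s i t)) \<partial>M) < 1) sequentially"
    by (rule order_tendstoD(2)[OF s(2)]) simp
  then obtain i where i: "(\<integral>\<^sup>+ t. ennreal (norm (f t - s i t)) \<partial>M) < 1"
    by (auto simp: eventually_sequentially)
  have fin: "(\<integral>\<^sup>+ t. norm (s i t) \<partial>M) < \<infinity>"
    by (subst Bochner_Integration.simple_bochner_integral_eq_nn_integral[symmetric])
      (simp_all add: Bochner_Integration.simple_bochner_integrable_compose2[OF _ s(1) s(1), where p="\<lambda>x y. norm x"])
  have "(\<integral>\<^sup>+ t. ennreal (norm (f t)) \<partial>M) \<le> (\<integral>\<^sup>+ t. ennreal (norm (f t - s i t)) + norm (s i t) \<partial>M)"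
  proof (intro nn_integral_mono)
    fix t
    have "ennreal (norm (f t)) \<le> ennreal (norm (f t - s i t) + norm (s i t))"
      using norm_triangle_ineq[of "f t - s i t" "s i t"] by (intro ennreal_leI) simp
    then show "ennreal (norm (f t)) \<le> ennreal (norm (f t - s i t)) + norm (s i t)" by simp
  qed
  also have "\<dots> = (\<integral>\<^sup>+ t. ennreal (norm (f t - s i t)) \<partial>M) + (\<integral>\<^sup>+ t. norm (s i t) \<partial>M)"
    by (rule nn_integral_add) auto
  also have "\<dots> < \<infinity>" using i fin by (auto simp: less_top[symmetric] top_unique)
  finally show ?thesis .
qed

section \<open>Test functions\<close>

text \<open>The whole sequence of derivatives is the witness. Sums, affine substitutions and
  antiderivatives then act on sequences term by term, without computing iterates of
  \<open>deriv\<close>.\<close>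

definition smooth :: "(real \<Rightarrow> real) \<Rightarrow> bool" where
  "smooth f \<longleftrightarrow> (\<exists>D. D 0 = f \<and> (\<forall>k x. (D k has_real_derivative D (Suc k) x) (at x)))"

lemma smooth_funpow_deriv:
  assumes "D 0 = f" "\<And>k x. (D k has_real_derivative D (Suc k) x) (at x)"
  shows "(deriv ^^ k) f = D k"
  by (induction k) (auto simp: assms intro!: ext DERIV_imp_deriv)

lemma smooth_differentiable:
  assumes "smooth f" shows "(deriv ^^ k) f differentiable_on UNIV"
proof -
  obtain D where D: "D 0 = f" "\<And>k x. (D k has_real_derivative D (Suc k) x) (at x)"
    using assms unfolding smooth_def by blast
  show ?thesis
    unfolding smooth_funpow_deriv[OF D] differentiable_on_def
    using D(2)[of k] real_differentiable_def by blast
qed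

lemma smooth_deriv: assumes "smooth f" shows "smooth (deriv f)"
proof -
  obtain D where D: "D 0 = f" "\<And>k x. (D k has_real_derivative D (Suc k) x) (at x)"
    using assms unfolding smooth_def by blast
  have "deriv f = D 1" using smooth_funpow_deriv[OF D, of 1] by simp
  then show ?thesis unfolding smooth_def using D(2) by (intro exI[of _ "\<lambda>k. D (Suc k)"]) auto
qed

lemma smooth_antideriv:
  assumes "smooth f" "\<And>x. (F has_real_derivative f x) (at x)" shows "smooth F"
proof -
  obtain D where D: "D 0 = f" "\<And>k x. (D k has_real_derivative D (Suc k) x) (at x)"
    using assms(1) unfolding smooth_def by blast
  have "((case k of 0 \<Rightarrow> F | Suc j \<Rightarrow> D j) has_real_derivative D k x) (at x)" for k x
    using assms(2) D by (cases k) auto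
  then show ?thesis unfolding smooth_def by (intro exI[of _ "\<lambda>k. case k of 0 \<Rightarrow> F | Suc j \<Rightarrow> D j"]) auto
qed

lemma smooth_affine:
  assumes "smooth f" shows "smooth (\<lambda>x. a * f (b * x + c))"
proof -
  obtain D where D: "D 0 = f" "\<And>k x. (D k has_real_derivative D (Suc k) x) (at x)"
    using assms unfolding smooth_def by blast
  have "((\<lambda>x. a * b ^ k * D k (b * x + c)) has_real_derivative a * b ^ Suc k * D (Suc k) (b * x + c)) (at x)" for k x
  proof -
    have "((\<lambda>x. D k (b * x + c)) has_real_derivative D (Suc k) (b * x + c) * b) (at x)"
      by (rule DERIV_chain2[OF D(2)]) (auto intro!: derivative_eq_intros)
    from DERIV_cmult[OF this, of "a * b ^ k"] show ?thesis by (simp add: mult_ac)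
  qed
  then show ?thesis unfolding smooth_def using D(1)
    by (intro exI[of _ "\<lambda>k x. a * b ^ k * D k (b * x + c)"]) auto
qed

lemma smooth_add:
  assumes "smooth f" "smooth g" shows "smooth (\<lambda>x. f x + g x)"
proof -
  obtain D where D: "D 0 = f" "\<And>k x. (D k has_real_derivative D (Suc k) x) (at x)"
    using assms unfolding smooth_def by blast
  obtain E where E: "E 0 = g" "\<And>k x. (E k has_real_derivative E (Suc k) x) (at x)"
    using assms unfolding smooth_def by blast
  show ?thesis unfolding smooth_def using D E
    by (intro exI[of _ "\<lambda>k x. D k x + E k x"]) (auto intro!: DERIV_add)
qed

lemma test_functionI:
  assumes "smooth f" "0 < a" "\<And>t. f t \<noteq> 0 \<Longrightarrow> a \<le> t \<and> t \<le> b"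
  shows "test_function f"
proof -
  have sub: "closure {t. f t \<noteq> 0} \<subseteq> {a..b}"
    using assms(3) by (intro closure_minimal) auto
  then have "bounded (closure {t. f t \<noteq> 0})"
    by (rule bounded_subset[OF bounded_closed_interval])
  then show ?thesis
    using sub assms(2) smooth_differentiable[OF assms(1)]
    by (auto simp: test_function_def compact_eq_bounded_closed)
qed

section \<open>A smooth bump function built from exp(-1/x)\<close>

text \<open>\<open>P = 1\<close> gives the classical smooth function that is flat at 0. The
  polynomial factor makes the family closed under differentiation.\<close>

definition flat :: "real poly \<Rightarrow> real \<Rightarrow> real" where
  "flat P x = (if x \<le> 0 then 0 else poly P (1 / x) * exp (- (1 / x)))"

lemma poly_times_exp_minus_tendsto_0:
  "((\<lambda>y::real. y ^ k * poly P y * exp (- y)) \<longlongrightarrow> 0) at_top"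
\<comment> \<open>The power \<open>y ^ k\<close> is generalised so that the factor \<open>y\<close>
  split off from the polynomial is absorbed into it.\<close>
proof (induction P arbitrary: k)
  case 0 then show ?case by simp
next
  case (pCons a P)
  have "((\<lambda>y. a * (y ^ k / exp y) + y ^ Suc k * poly P y * exp (- y)) \<longlongrightarrow> a * 0 + 0) at_top"
    by (intro tendsto_intros tendsto_power_div_exp_0 pCons)
  then show ?case by (simp add: algebra_simps exp_minus divide_inverse)
qed

lemma flat_tendsto_0: "(flat P \<longlongrightarrow> 0) (at 0)"
proof -
  have "((\<lambda>x::real. poly P (inverse x) * exp (- inverse x)) \<longlongrightarrow> 0) (at_right 0)"
    using filterlim_compose[OF poly_times_exp_minus_tendsto_0[of 0 P] filterlim_inverse_at_top_right] by simp
  moreover have "eventually (\<lambda>x. poly P (inverse x) * exp (- inverse x) = flat P x) (at_right 0)"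
    by (auto simp: flat_def eventually_at_filter inverse_eq_divide)
  ultimately have r: "(flat P \<longlongrightarrow> 0) (at_right 0)"
    by (rule Lim_transform_eventually)
  have "eventually (\<lambda>x. 0 = flat P x) (at_left 0)"
    by (auto simp: flat_def eventually_at_filter)
  then have "(flat P \<longlongrightarrow> 0) (at_left 0)"
    using tendsto_cong[of "\<lambda>x. 0" "flat P" "at_left 0" 0] by simp
  with r show ?thesis by (simp add: filterlim_at_split)
qed

text \<open>With y = 1/x one has dy/dx = -y^2, so P(y) exp(-y) has derivative y^2 (P - P')(y)
  exp(-y). At 0 the difference quotient is again a flat function, with polynomial y P(y), and tends
  to 0.\<close>

lemma flat_has_derivative:
  "(flat P has_real_derivative flat ([:0, 0, 1:] * (P - pderiv P)) x) (at x)"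
proof -
  consider "x < 0" | "x = 0" | "x > 0" by linarith
  then show ?thesis
  proof cases
    case 1
    have "((\<lambda>x. 0) has_real_derivative flat ([:0, 0, 1:] * (P - pderiv P)) x) (at x)"
      using 1 by (simp add: flat_def)
    then show ?thesis
      by (rule has_field_derivative_transform_within_open[of _ _ _ "{..<0}"]) (use 1 in \<open>auto simp: flat_def\<close>)
  next
    case 2
    have "(flat ([:0, 1:] * P) \<longlongrightarrow> 0) (at 0)" by (rule flat_tendsto_0)
    moreover have "eventually (\<lambda>x. flat ([:0, 1:] * P) x = (flat P x - flat P 0) / (x - 0)) (at 0)"
      by (auto simp: flat_def eventually_at_filter)
    ultimately have "((\<lambda>x. (flat P x - flat P 0) / (x - 0)) \<longlongrightarrow> 0) (at 0)"
      by (rule Lim_transform_eventually)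
    then show ?thesis using 2 by (simp add: has_field_derivative_iff flat_def)
  next
    case 3
    have i: "((\<lambda>x. 1 / x) has_real_derivative - (1 / x\<^sup>2)) (at x)"
      using 3 by (auto intro!: derivative_eq_intros simp: power2_eq_square)
    have "((\<lambda>x. poly P (1 / x) * exp (- (1 / x))) has_real_derivative
        flat ([:0, 0, 1:] * (P - pderiv P)) x) (at x)"
      using DERIV_mult[OF DERIV_chain2[OF poly_DERIV i, of P] DERIV_chain2[OF DERIV_exp DERIV_minus[OF i]]] 3
      by (simp add: flat_def algebra_simps power2_eq_square)
    then show ?thesis
      by (rule has_field_derivative_transform_within_open[of _ _ _ "{0<..}"]) (use 3 in \<open>auto simp: flat_def\<close>)
  qed
qed

text \<open>Every member vanishes outside (0,1), and the product rule keeps derivatives inside the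
  set. Hence membership alone gives derivatives of all orders.\<close>

inductive_set bumps :: "(real \<Rightarrow> real) set" where
  prod: "(\<lambda>x. flat P x * flat Q (1 - x)) \<in> bumps"
| add: "f \<in> bumps \<Longrightarrow> g \<in> bumps \<Longrightarrow> (\<lambda>x. f x + g x) \<in> bumps"

lemma bumps_deriv:
  assumes "f \<in> bumps" shows "\<exists>f'\<in>bumps. \<forall>x. (f has_real_derivative f' x) (at x)"
  using assms
proof induction
  case (prod P Q)
  let ?d = "\<lambda>P. [:0, 0, 1:] * (P - pderiv P)"
  \<comment> \<open>The sign produced by the inner function \<open>1 - x\<close> is moved into the
    polynomial, so that the derivative has the form required by the generating rule.\<close>
  have eq: "flat (- R) y = - flat R y" for R y by (simp add: flat_def)
  have "((\<lambda>x. flat P x * flat Q (1 - x)) has_real_derivative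
      flat (?d P) x * flat Q (1 - x) + flat P x * flat (- ?d Q) (1 - x)) (at x)" for x
  proof -
    have "((\<lambda>x. flat Q (1 - x)) has_real_derivative flat (?d Q) (1 - x) * (- 1)) (at x)"
      by (rule DERIV_chain2[OF flat_has_derivative]) (auto intro!: derivative_eq_intros)
    from DERIV_mult[OF flat_has_derivative[of P x] this] show ?thesis
      unfolding eq by (simp add: mult.commute)
  qed
  then show ?case
    by (intro bexI[OF _ bumps.add[OF bumps.prod[of "?d P" Q] bumps.prod[of P "- ?d Q"]]] allI)
next
  case (add f g)
  then obtain f' g' where "f' \<in> bumps" "g' \<in> bumps"
    "\<And>x. (f has_real_derivative f' x) (at x)" "\<And>x. (g has_real_derivative g' x) (at x)" by blast
  then show ?case using bumps.add by (intro bexI[of _ "\<lambda>x. f' x + g' x"]) (auto intro!: DERIV_add)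
qed

lemma smooth_bumps:
  assumes "f \<in> bumps" shows "smooth f"
proof -
  have D: "deriv g \<in> bumps \<and> (\<forall>x. (g has_real_derivative deriv g x) (at x))" if gb: "g \<in> bumps" for g
  proof -
    obtain g' where g': "g' \<in> bumps" "\<And>x. (g has_real_derivative g' x) (at x)"
      using bumps_deriv[OF gb] by blast
    moreover have "deriv g = g'" using g'(2) by (auto intro!: ext DERIV_imp_deriv)
    ultimately show ?thesis by simp
  qed
  have "(deriv ^^ k) f \<in> bumps" for k by (induction k) (use assms D in auto)
  then show ?thesis unfolding smooth_def using D by (intro exI[of _ "\<lambda>k. (deriv ^^ k) f"]) simp
qed

lemma exists_bump:
  obtains \<rho> where "smooth \<rho>" "\<And>x. 0 \<le> \<rho> x" "\<And>x. 0 < x \<Longrightarrow> x < 1 \<Longrightarrow> 0 < \<rho> x" "\<And>x. x \<le> 0 \<or> 1 \<le> x \<Longrightarrow> \<rho> x = 0"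
  \<comment> \<open>The bump is exp(-1/x) exp(-1/(1-x)) on (0,1).\<close>
  by (rule that[OF smooth_bumps[OF bumps.prod[of 1 1]]]) (auto simp: flat_def)

section \<open>Smoothing the positive part and the tent\<close>

lemma exists_antiderivative:
  fixes f :: "real \<Rightarrow> real"
  assumes "\<And>x. isCont f x"
  obtains F where "\<And>x. (F has_real_derivative f x) (at x)"
  using einterval_antiderivative[of "-\<infinity>" "\<infinity>" f] assms
  by (auto simp: has_real_derivative_iff_has_vector_derivative)

lemma smooth_isCont: "smooth f \<Longrightarrow> isCont f x"
  using smooth_differentiable[of f 0] differentiable_imp_continuous_on[of f UNIV]
  by (simp add: continuous_on_eq_continuous_at)

lemma exists_normalised_antiderivative:
  assumes "smooth f"
  obtains F where "smooth F" "\<And>x. (F has_real_derivative f x) (at x)" "F 0 = 0"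
proof -
  obtain G where G: "\<And>x. (G has_real_derivative f x) (at x)"
    using exists_antiderivative[of f] smooth_isCont[OF assms] by blast
  have "((\<lambda>x. G x - G 0) has_real_derivative f x) (at x)" for x
    using DERIV_diff[OF G DERIV_const] by simp
  then show ?thesis
    using smooth_antideriv[OF assms] by (intro that[of "\<lambda>x. G x - G 0"]) auto
qed

text \<open>Integrating a normalised bump gives a smooth step \<open>\<Theta>\<close> from 0 to 1,
  and integrating once more gives a smooth version \<open>\<Phi>\<close> of the positive part. The
  mass of \<open>\<rho>\<close> lies in [0,1], which is why \<open>\<Phi>\<close> is exactly affine
  from 1 on.\<close>

lemma exists_smooth_ramp:
  obtains \<Phi> \<Theta> \<rho> :: "real \<Rightarrow> real" and c where
    "smooth \<Phi>" "\<And>x. (\<Phi> has_real_derivative \<Theta> x) (at x)" "\<And>x. (\<Theta> has_real_derivative \<rho> x) (at x)"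
    "continuous_on UNIV \<rho>" "\<And>x. 0 \<le> \<rho> x" "\<And>x. \<rho> x \<noteq> 0 \<Longrightarrow> 0 \<le> x \<and> x \<le> 1"
    "has_bochner_integral lborel \<rho> 1"
    "\<And>x. x \<le> 0 \<Longrightarrow> \<Phi> x = 0" "\<And>x. 1 \<le> x \<Longrightarrow> \<Phi> x = x + c" "\<And>x. \<bar>\<Phi> x - max 0 x\<bar> \<le> 1"
proof -
  obtain b where b: "smooth b" "\<And>x. 0 \<le> b x" "\<And>x. 0 < x \<Longrightarrow> x < 1 \<Longrightarrow> 0 < b x"
    "\<And>x. x \<le> 0 \<or> 1 \<le> x \<Longrightarrow> b x = 0" by (metis exists_bump)
  obtain B where B: "smooth B" "\<And>x. (B has_real_derivative b x) (at x)" "B 0 = 0"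
    using exists_normalised_antiderivative[OF b(1)] by blast
  have contB: "continuous_on S B" for S
    using smooth_isCont[OF B(1)] by (simp add: continuous_at_imp_continuous_on)
  have B1: "0 < B 1"
    using DERIV_pos_imp_increasing_open[of 0 1 B] B b contB by force
  define \<Theta> where "\<Theta> x = B x / B 1" for x
  define \<rho> where "\<rho> x = b x / B 1" for x
  have sT: "smooth \<Theta>"
    using smooth_affine[OF B(1), of "1 / B 1" 1 0] by (simp add: \<Theta>_def[abs_def])
  have T: "(\<Theta> has_real_derivative \<rho> x) (at x)" for x
    unfolding \<Theta>_def \<rho>_def using DERIV_cdivide[OF B(2)] .
  have \<rho>: "continuous_on UNIV \<rho>" "\<And>x. 0 \<le> \<rho> x" "\<And>x. x \<le> 0 \<or> 1 \<le> x \<Longrightarrow> \<rho> x = 0"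
    using b B1 smooth_isCont[OF b(1)]
    by (auto simp: \<rho>_def[abs_def] intro!: continuous_intros continuous_at_imp_continuous_on)
  have Tmono: "\<Theta> x \<le> \<Theta> y" if "x \<le> y" for x y
    using DERIV_nonneg_imp_nondecreasing[OF that, of \<Theta>] T \<rho>(2) by blast
  have T1: "\<Theta> 1 = 1" "\<Theta> 0 = 0" using B1 B(3) by (auto simp: \<Theta>_def)
  have Tneg: "\<Theta> x = 0" if "x \<le> 0" for x
  proof -
    have "\<Theta> 0 \<le> \<Theta> x"
      by (rule DERIV_nonpos_imp_nonincreasing[OF that, of \<Theta>]) (use T \<rho>(3) in \<open>metis order_refl\<close>)
    with Tmono[OF that] T1 show ?thesis by simp
  qed
  have Tbig: "\<Theta> x = 1" if "1 \<le> x" for x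
  proof -
    have "\<Theta> x \<le> \<Theta> 1"
      by (rule DERIV_nonpos_imp_nonincreasing[OF that, of \<Theta>]) (use T \<rho>(3) in \<open>metis order_refl\<close>)
    with Tmono[OF that] T1 show ?thesis by simp
  qed
  have T01: "0 \<le> \<Theta> x" "\<Theta> x \<le> 1" for x
    using Tmono[of 0 x] Tmono[of x 1] Tneg[of x] Tbig[of x] T1 by linarith+
  obtain \<Phi> where F: "smooth \<Phi>" "\<And>x. (\<Phi> has_real_derivative \<Theta> x) (at x)" "\<Phi> 0 = 0"
    using exists_normalised_antiderivative[OF sT] by blast
  have Fmono: "\<Phi> x \<le> \<Phi> y" if "x \<le> y" for x y
    using DERIV_nonneg_imp_nondecreasing[OF that, of \<Phi>] F(2) T01 by blast
  have Fneg: "\<Phi> x = 0" if "x \<le> 0" for x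
  proof -
    have "\<Phi> 0 \<le> \<Phi> x"
      by (rule DERIV_nonpos_imp_nonincreasing[OF that, of \<Phi>]) (use F Tneg in \<open>metis order_refl\<close>)
    with Fmono[OF that] F(3) show ?thesis by simp
  qed
  have dF: "((\<lambda>x. x - \<Phi> x) has_real_derivative 1 - \<Theta> x) (at x)" for x
    by (rule DERIV_diff[OF DERIV_ident F(2)])
  \<comment> \<open>Since \<open>\<Theta>\<close> is at most 1, \<open>x - \<Phi> x\<close> is
    nondecreasing. On [0,1] it therefore runs from 0 to \<open>1 - \<Phi> 1\<close>, and from 1 on
    it keeps that value. This yields both the bound 1 and the constant
    \<open>c = \<Phi> 1 - 1\<close>.\<close>
  have Gmono: "x - \<Phi> x \<le> y - \<Phi> y" if "x \<le> y" for x y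
    by (rule DERIV_nonneg_imp_nondecreasing[OF that]) (use dF T01 in fastforce)
  have Gbig: "x - \<Phi> x = 1 - \<Phi> 1" if "1 \<le> x" for x
  proof -
    have "x - \<Phi> x \<le> 1 - \<Phi> 1"
      by (rule DERIV_nonpos_imp_nonincreasing[OF that]) (use dF Tbig in fastforce)
    with Gmono[OF that] show ?thesis by simp
  qed
  have F1: "0 \<le> \<Phi> 1" using Fmono[of 0 1] F(3) by simp
  have near: "\<bar>\<Phi> x - max 0 x\<bar> \<le> 1" for x
    using Gmono[of 0 x] Gmono[of x 1] Fneg[of x] Gbig[of x] F(3) F1
    by (cases "x \<le> 0"; cases "x \<le> 1") auto
  have "has_bochner_integral lborel (\<lambda>x. \<rho> x * indicator {0..1} x) (\<Theta> 1 - \<Theta> 0)"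
    by (rule has_bochner_integral_FTC_Icc_real)
      (use T \<rho>(1) in \<open>auto intro: DERIV_subset simp: continuous_on_eq_continuous_at\<close>)
  moreover have "(\<lambda>x. \<rho> x * indicator {0..1} x) = \<rho>"
  proof
    show "\<rho> x * indicator {0..1} x = \<rho> x" for x
      using \<rho>(3)[of x] by (cases "x \<le> 0"; cases "1 \<le> x") auto
  qed
  ultimately have I: "has_bochner_integral lborel \<rho> 1" using T1 by simp
  have supp: "0 \<le> x \<and> x \<le> 1" if "\<rho> x \<noteq> 0" for x using \<rho>(3)[of x] that linear by blast
  have big: "\<Phi> x = x + (\<Phi> 1 - 1)" if "1 \<le> x" for x using Gbig[OF that] by simp
  show ?thesis
    by (rule that[of \<Phi> \<Theta> \<rho> "\<Phi> 1 - 1"]) (fact F(1) F(2) T \<rho>(1) \<rho>(2) supp I Fneg big near)+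
qed

text \<open>The tent is the second difference with step \<open>h\<close> of the positive part, so
  \<open>\<xi>\<close> is the same combination of the rescaled ramp
  \<open>\<Psi> x = \<epsilon> * \<Phi> (x / \<epsilon>)\<close>. Each copy of \<open>\<Psi>\<close>
  is off by at most \<open>\<epsilon>\<close>, and the weights 1, 1 and 2 add up to 4. The mollifier
  \<open>r\<close> sits to the right of 0, so only the right end of the support grows.\<close>

lemma exists_kernel:
  fixes z h \<epsilon> :: real
  assumes "0 < \<epsilon>" "0 < h" "h < z"
  obtains \<xi> r where "test_function \<xi>" "test_function (deriv \<xi>)"
    "\<And>t. deriv (deriv \<xi>) t = r (t - (z - h)) + r (t - (z + h)) - 2 * r (t - z)"
    "continuous_on UNIV r" "\<And>x. 0 \<le> r x" "\<And>x. r x \<noteq> 0 \<Longrightarrow> 0 \<le> x \<and> x \<le> \<epsilon>"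
    "has_bochner_integral lborel r 1"
    "\<And>t. \<bar>\<xi> t - max 0 (h - \<bar>t - z\<bar>)\<bar> \<le> 4 * \<epsilon>"
    "\<And>t. \<xi> t \<noteq> 0 \<Longrightarrow> z - h \<le> t \<and> t \<le> z + h + \<epsilon>"
proof -
  obtain \<Phi> \<Theta> \<rho> :: "real \<Rightarrow> real" and c where
    F: "smooth \<Phi>" "\<And>x. (\<Phi> has_real_derivative \<Theta> x) (at x)" "\<And>x. (\<Theta> has_real_derivative \<rho> x) (at x)"
    "continuous_on UNIV \<rho>" "\<And>x. 0 \<le> \<rho> x" "\<And>x. \<rho> x \<noteq> 0 \<Longrightarrow> 0 \<le> x \<and> x \<le> 1"
    "has_bochner_integral lborel \<rho> 1"
    "\<And>x. x \<le> 0 \<Longrightarrow> \<Phi> x = 0" "\<And>x. 1 \<le> x \<Longrightarrow> \<Phi> x = x + c" "\<And>x. \<bar>\<Phi> x - max 0 x\<bar> \<le> 1"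
    by (metis exists_smooth_ramp)
  define \<Psi> where "\<Psi> x = \<epsilon> * \<Phi> (1 / \<epsilon> * x + 0)" for x
  define r where "r x = 1 / \<epsilon> * \<rho> (1 / \<epsilon> * x + 0)" for x
  define \<Psi>' where "\<Psi>' x = \<Theta> (1 / \<epsilon> * x + 0)" for x
  have sP: "smooth (\<lambda>t. a * \<Psi> (t - s))" for a s
    using smooth_affine[OF F(1), of "a * \<epsilon>" "1 / \<epsilon>" "- s / \<epsilon>"]
    by (simp add: \<Psi>_def diff_divide_distrib mult.assoc)
  have dP: "(\<Psi> has_real_derivative \<Psi>' x) (at x)" for x
    unfolding \<Psi>_def \<Psi>'_def using assms(1)
    by (auto intro!: derivative_eq_intros DERIV_chain2[OF F(2)])
  have dP': "(\<Psi>' has_real_derivative r x) (at x)" for x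
  proof -
    have "((\<lambda>x. \<Theta> (1 / \<epsilon> * x + 0)) has_real_derivative \<rho> (1 / \<epsilon> * x + 0) * (1 / \<epsilon>)) (at x)"
      by (rule DERIV_chain2[OF F(3)]) (use assms(1) in \<open>auto intro!: derivative_eq_intros\<close>)
    then show ?thesis by (simp add: \<Psi>'_def[abs_def] r_def mult.commute)
  qed
  have P0: "\<Psi> x = 0" if "x \<le> 0" for x
    using that assms(1) by (simp add: \<Psi>_def F(8) divide_nonpos_pos)
  have P1: "\<Psi> x = x + \<epsilon> * c" if "\<epsilon> \<le> x" for x
    using that assms(1) by (simp add: \<Psi>_def F(9) algebra_simps)
  have Pnear: "\<bar>\<Psi> x - max 0 x\<bar> \<le> \<epsilon>" for x
  proof -
    have "\<Psi> x - max 0 x = \<epsilon> * (\<Phi> (x / \<epsilon>) - max 0 (x / \<epsilon>))"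
      using assms(1) by (auto simp: \<Psi>_def algebra_simps max_def divide_simps)
    then show ?thesis using F(10)[of "x / \<epsilon>"] assms(1) by (simp add: abs_mult)
  qed
  define \<xi> where "\<xi> t = 1 * \<Psi> (t - (z - h)) + 1 * \<Psi> (t - (z + h)) + (- 2) * \<Psi> (t - z)" for t
  define \<xi>' where "\<xi>' t = 1 * \<Psi>' (t - (z - h)) + 1 * \<Psi>' (t - (z + h)) + (- 2) * \<Psi>' (t - z)" for t
  have s: "smooth \<xi>" unfolding \<xi>_def by (intro smooth_add sP)
  have shift: "((\<lambda>t. a * f (t - s)) has_real_derivative a * f' (t - s)) (at t)"
    if "\<And>x. (f has_real_derivative f' x) (at x)" for a s t and f f' :: "real \<Rightarrow> real"
    by (auto intro!: derivative_eq_intros DERIV_chain2[OF that])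
  have d: "deriv \<xi> = \<xi>'"
    unfolding \<xi>_def \<xi>'_def by (intro ext DERIV_imp_deriv DERIV_add shift dP)
  have d': "deriv \<xi>' t = 1 * r (t - (z - h)) + 1 * r (t - (z + h)) + (- 2) * r (t - z)" for t
    unfolding \<xi>'_def by (intro DERIV_imp_deriv DERIV_add shift dP')
  have supp: "z - h \<le> t \<and> t \<le> z + h + \<epsilon>" if "\<xi> t \<noteq> 0" for t
  proof (rule ccontr)
    assume "\<not> (z - h \<le> t \<and> t \<le> z + h + \<epsilon>)"
    then consider "t < z - h" | "z + h + \<epsilon> < t" by linarith
    \<comment> \<open>To the right of \<open>z + h + \<epsilon>\<close> all three terms are affine,
      and slopes and constants cancel with weights 1, 1, -2.\<close>
    then have "\<xi> t = 0" by cases (use assms(2) in \<open>simp_all add: \<xi>_def P0 P1\<close>)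
    with that show False by simp
  qed
  have supp': "z - h \<le> t \<and> t \<le> z + h + \<epsilon>" if "\<xi>' t \<noteq> 0" for t
  proof (rule ccontr)
    assume n: "\<not> (z - h \<le> t \<and> t \<le> z + h + \<epsilon>)"
    have "open (- {z - h .. z + h + \<epsilon>})" by auto
    moreover have "t \<in> - {z - h .. z + h + \<epsilon>}" "\<And>y. y \<in> - {z - h .. z + h + \<epsilon>} \<Longrightarrow> 0 = \<xi> y"
      using n supp by force+
    ultimately have "(\<xi> has_real_derivative 0) (at t)"
      using has_field_derivative_transform_within_open[OF DERIV_const] by blast
    then have "\<xi>' t = 0" using d DERIV_imp_deriv by force
    with that show False by simp
  qed
  have near: "\<bar>\<xi> t - max 0 (h - \<bar>t - z\<bar>)\<bar> \<le> 4 * \<epsilon>" for t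
  proof -
    have "max 0 (h - \<bar>t - z\<bar>) = max 0 (t - (z - h)) + max 0 (t - (z + h)) - 2 * max 0 (t - z)"
      using assms(2) by (auto simp: max_def abs_if)
    moreover have "\<bar>1 * a + 1 * b + (- 2) * c - m\<bar> \<le> 4 * e"
      if "\<bar>a - a'\<bar> \<le> e" "\<bar>b - b'\<bar> \<le> e" "\<bar>c - c'\<bar> \<le> e" "m = a' + b' - 2 * c'"
      for a a' b b' c c' m e :: real
      using that by linarith
    ultimately show ?thesis
      unfolding \<xi>_def using Pnear by blast
  qed
  have I: "has_bochner_integral lborel r 1"
  proof -
    have "has_bochner_integral lborel (\<lambda>x. \<rho> (0 + 1 / \<epsilon> * x)) (1 /\<^sub>R \<bar>1 / \<epsilon>\<bar>)"
      using assms(1) F(7) by (intro lborel_has_bochner_integral_real_affine_iff[THEN iffD1]) auto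
    from has_bochner_integral_mult_right[OF this, of "1 / \<epsilon>"] show ?thesis
      using assms(1) by (simp add: r_def[abs_def])
  qed
  have r: "continuous_on UNIV r" "0 \<le> r x" "r x \<noteq> 0 \<Longrightarrow> 0 \<le> x \<and> x \<le> \<epsilon>" for x
    using assms(1) F(5) F(6)[of "x / \<epsilon>"]
    by (auto simp: r_def[abs_def] zero_le_divide_iff divide_le_eq_1
        intro!: continuous_intros continuous_on_compose2[OF F(4)])
  have d'': "deriv (deriv \<xi>) t = r (t - (z - h)) + r (t - (z + h)) - 2 * r (t - z)" for t
    using d'[of t] d by simp
  have zh: "0 < z - h" using assms by simp
  have t1: "test_function \<xi>" by (rule test_functionI[OF s zh supp])
  have t2: "test_function (deriv \<xi>)"
    by (rule test_functionI[OF smooth_deriv[OF s] zh]) (use supp' d in auto)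
  show ?thesis
    by (rule that[of \<xi> r]) (fact t1 t2 d'' r I near supp)+
qed

section \<open>Accretive operators and midpoint convexity\<close>

text \<open>Pair \<open>x + l *\<^sub>R A x\<close> with the functional \<open>x'\<close> from the
  duality map: the real part is at least the square of \<open>norm x\<close>, and at most
  \<open>norm x * norm (x + l *\<^sub>R A x)\<close>.\<close>

lemma accretive_norm_le:
  fixes smul :: "'k::{real_normed_field,real_inner} \<Rightarrow> 'a::banach \<Rightarrow> 'a"
  assumes acc: "accretive smul D A" and "x \<in> D" "0 \<le> l"
  shows "norm x \<le> norm (x + l *\<^sub>R A x)"
proof (cases "x = 0")
  case False
  obtain x' :: "'a \<Rightarrow> 'k" where x': "bounded_linear x'" "x' x = of_real ((norm x)\<^sup>2)" "(norm x)\<^sup>2 = (onorm x')\<^sup>2"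
    and re: "0 \<le> re_part (x' (A x))"
    using acc \<open>x \<in> D\<close> unfolding accretive_def duality_map_def dual_space_def by blast
  interpret x': bounded_linear x' by fact
  have on: "onorm x' = norm x"
    using x'(3) onorm_pos_le[OF x'(1)] by (metis norm_ge_zero power2_eq_iff_nonneg)
  \<comment> \<open>The real part of the unit is \<open>inner 1 1\<close>, which is 1 because the
    unit has norm 1.\<close>
  have "re_part (of_real ((norm x)\<^sup>2) :: 'k) = (norm x)\<^sup>2"
    by (simp add: re_part_def of_real_def norm_eq_1[symmetric])
  then have "(norm x)\<^sup>2 \<le> re_part (x' (x + l *\<^sub>R A x))"
    using re \<open>0 \<le> l\<close> by (simp add: re_part_def inner_add_left x'(2) x'.add x'.scaleR)
  also have "\<dots> \<le> norm (x' (x + l *\<^sub>R A x))"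
    using norm_cauchy_schwarz[of "x' (x + l *\<^sub>R A x)" 1] by (simp add: re_part_def)
  also have "\<dots> \<le> norm x * norm (x + l *\<^sub>R A x)"
    using onorm[OF x'(1), of "x + l *\<^sub>R A x"] on by simp
  finally show ?thesis using False by (simp add: power2_eq_square)
qed simp

lemma linear_operator_diff:
  fixes smul :: "'k::{real_normed_field,real_inner} \<Rightarrow> 'a::banach \<Rightarrow> 'a"
  assumes "banach_space_over smul" "linear_operator smul D A" "x \<in> D" "y \<in> D"
  shows "x - y \<in> D" "A (x - y) = A x - A y"
proof -
  interpret banach_space_over smul by fact
  have m: "smul (- 1) w = - w" for w by simp
  have D: "- y \<in> D" "x - y \<in> D"
    using assms(2-4) subspace_diff[of D] subspace_neg[of D] by (auto simp: linear_operator_def)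
  then have "A (x + smul (- 1) y) = A x + smul (- 1) (A y)"
    using assms(2-4) unfolding linear_operator_def by (metis m)
  with D show "x - y \<in> D" "A (x - y) = A x - A y" by (simp_all add: m)
qed

lemma midpoint_convex_le_chord:
  fixes Q :: "real \<Rightarrow> real"
  assumes cont: "continuous_on {0..R} Q" and R: "0 < R"
    and mid: "\<And>z. 0 < z \<Longrightarrow> z < R \<Longrightarrow>
      \<exists>h>0. h \<le> z \<and> z + h \<le> R \<and> 2 * Q z \<le> Q (z - h) + Q (z + h)"
    and a: "0 \<le> a" "a \<le> R"
  shows "Q a \<le> Q 0 + (Q R - Q 0) * (a / R)"
proof -
  define c where "c = (Q R - Q 0) / R"
  define S where "S z = Q z - (Q 0 + c * z)" for z
  have cS: "continuous_on {0..R} S"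
    unfolding S_def by (intro continuous_intros cont)
  obtain w where w: "w \<in> {0..R}" "\<And>z. z \<in> {0..R} \<Longrightarrow> S z \<le> S w"
    using continuous_attains_sup[OF _ _ cS] R by force
  define K where "K = {z \<in> {0..R}. S z = S w}"
  have "closed K" unfolding K_def by (rule continuous_closed_preimage_constant[OF cS]) auto
  then have "compact K" by (auto simp: compact_eq_bounded_closed K_def intro: bounded_subset[of "{0..R}"])
  moreover have "K \<noteq> {}" using w(1) by (auto simp: K_def)
  ultimately obtain v where v: "v \<in> K" "\<And>z. z \<in> K \<Longrightarrow> v \<le> z"
    by (meson compact_attains_inf)
  have "S w \<le> 0"
  proof (rule ccontr)
    assume "\<not> S w \<le> 0"
    moreover have "S 0 = 0" "S R = 0" using R by (auto simp: S_def c_def)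
    ultimately have "0 < v" "v < R" using v(1) by (auto simp: K_def less_le)
    then obtain h where h: "0 < h" "h \<le> v" "v + h \<le> R" "2 * Q v \<le> Q (v - h) + Q (v + h)"
      using mid by blast
    have "2 * S v \<le> S (v - h) + S (v + h)"
      using h(4) by (simp add: S_def algebra_simps)
    moreover have "S (v - h) < S w"
    proof -
      have "v - h \<notin> K" using v(2)[of "v - h"] h(1) by auto
      then show ?thesis using w(2)[of "v - h"] h \<open>v < R\<close> by (auto simp: K_def)
    qed
    moreover have "S (v + h) \<le> S w" using w(2)[of "v + h"] h by auto
    moreover have "S v = S w" using v(1) by (simp add: K_def)
    ultimately show False by linarith
  qed
  then show ?thesis using w(2)[of a] a by (simp add: S_def c_def)
qed

section \<open>String measures\<close>

lemma space_string_measure [simp]: "space (string_measure m) = UNIV"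
  by (simp add: string_measure_def)

lemma borel_subset_string_measure: "A \<in> sets borel \<Longrightarrow> A \<in> sets (string_measure m)"
  by (simp add: string_measure_def)

lemma borel_measurable_string_measure:
  "f \<in> borel_measurable borel \<Longrightarrow> f \<in> borel_measurable (string_measure m)"
  by (simp add: string_measure_def measurable_completion measurable_cong_sets[OF sets_interval_measure refl])

lemma emeasure_string_measure_bounded:
  assumes "infinite_string m" "A \<subseteq> {a..b::real}"
  shows "emeasure (string_measure m) A < \<infinity>"
proof (cases "a \<le> b")
  case True
  \<comment> \<open>Moving the left end to \<open>a - 1\<close> gives a half-open interval that
    contains the point \<open>a\<close>, where \<open>m\<close> may jump.\<close>
  have "emeasure (string_measure m) A \<le> emeasure (string_measure m) {a - 1<..b}"
    using assms(2) by (intro emeasure_mono borel_subset_string_measure) auto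
  also have "\<dots> < \<infinity>" using True by (subst emeasure_string_measure_Ioc[OF assms(1)]) auto
  finally show ?thesis .
qed (use assms in simp)

lemma integrable_string_measure:
  fixes \<phi> :: "real \<Rightarrow> real"
  assumes m: "infinite_string m" and \<phi>: "\<phi> \<in> borel_measurable borel" "\<And>t. \<bar>\<phi> t\<bar> \<le> C * indicator {a..b} t"
  shows "integrable (string_measure m) \<phi>"
proof (rule Bochner_Integration.integrable_bound)
  show "integrable (string_measure m) (\<lambda>t. C * indicator {a..b} t)"
    using emeasure_string_measure_bounded[OF m order_refl, of a b]
    by (intro integrable_mult_right integrable_real_indicator borel_subset_string_measure) auto
  show "\<phi> \<in> borel_measurable (string_measure m)" by (rule borel_measurable_string_measure[OF \<phi>(1)])
  show "AE t in string_measure m. norm (\<phi> t) \<le> norm (C * indicator {a..b} t)"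
  proof (rule AE_I2)
    show "norm (\<phi> t) \<le> norm (C * indicator {a..b} t)" for t
      using \<phi>(2)[of t] by simp
  qed
qed

text \<open>Inner regularity is applied to a finite Borel measure. Hence \<open>B\<close> is
  replaced by its Borel main part \<open>B'\<close>, which has the same measure, and the measure is
  restricted to \<open>{a..b}\<close> through the density \<open>N\<close>.\<close>

lemma string_measure_inner_regular:
  assumes m: "infinite_string m" and B: "B \<in> sets (string_measure m)" "B \<subseteq> {a..b}" and "0 < \<eta>"
  obtains F where "compact F" "F \<subseteq> B" "measure (string_measure m) (B - F) \<le> \<eta>"
proof -
  let ?I = "interval_measure m" let ?M = "string_measure m"
  have Bc: "B \<in> sets (completion ?I)" using B(1) by (simp add: string_measure_def)
  define B' where "B' = main_part ?I B"
  have B': "B' \<in> sets borel" "B' \<subseteq> B" "emeasure ?M B = emeasure ?I B'"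
    using main_part_sets[OF Bc] main_part_null_part_Un[OF Bc] emeasure_completion[OF Bc]
    by (auto simp: B'_def string_measure_def)
  define N where "N = density ?I (indicator {a..b})"
  have eN: "emeasure N A = emeasure ?I (A \<inter> {a..b})" if "A \<in> sets borel" for A
  proof -
    have "emeasure N A = (\<integral>\<^sup>+x. indicator {a..b} x * indicator A x \<partial>?I)"
      unfolding N_def using that by (intro emeasure_density) auto
    also have "\<dots> = (\<integral>\<^sup>+x. indicator (A \<inter> {a..b}) x \<partial>?I)"
      by (intro nn_integral_cong) (auto simp: indicator_def)
    finally show ?thesis using that by simp
  qed
  have bor: "emeasure ?M A = emeasure ?I A" if "A \<in> sets borel" for A
    using that by (simp add: string_measure_def)
  have sN: "sets N = sets borel" by (simp add: N_def)
  have fin: "emeasure ?M A < \<infinity>" if "A \<subseteq> {a..b}" for A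
    using emeasure_string_measure_bounded[OF m that] .
  have "emeasure N (space N) \<noteq> \<infinity>"
    using eN[of UNIV] fin[of "{a..b}"] by (simp add: N_def bor)
  from inner_regular[OF sN this B'(1)]
  have sup: "emeasure ?I B' = (SUP K \<in> {K. K \<subseteq> B' \<and> compact K}. emeasure N K)"
    using eN[OF B'(1)] B'(2) B(2) by (simp add: Int_absorb2 subset_trans)
  have "emeasure ?I B' \<noteq> top" using fin[OF B(2)] B'(3) by simp
  moreover have ne: "{K. K \<subseteq> B' \<and> compact K} \<noteq> {}" using compact_empty by blast
  ultimately obtain K where K: "K \<subseteq> B'" "compact K" "emeasure ?I B' < emeasure N K + ennreal \<eta>"
    using SUP_approx_ennreal[OF \<open>0 < \<eta>\<close> ne sup] by auto
  have Kb: "K \<in> sets borel" using K(2) by (simp add: compact_imp_closed)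
  have Ksub: "K \<subseteq> B" using K(1) B'(2) by auto
  have "emeasure ?M B \<le> emeasure ?M K + ennreal \<eta>"
  proof -
    have "K \<inter> {a..b} = K" using Ksub B(2) by blast
    then show ?thesis using K(3) eN[OF Kb] unfolding B'(3) bor[OF Kb] by simp
  qed
  moreover have "emeasure ?M K = ennreal (measure ?M K)" "emeasure ?M B = ennreal (measure ?M B)"
    using fin[OF subset_trans[OF Ksub B(2)]] fin[OF B(2)] by (auto intro!: emeasure_eq_ennreal_measure)
  ultimately have "measure ?M B \<le> measure ?M K + \<eta>"
    using \<open>0 < \<eta>\<close> by (simp add: ennreal_plus[symmetric] del: ennreal_plus)
  moreover have "measure ?M (B - K) = measure ?M B - measure ?M K"
    using measure_Diff[OF _ B(1) borel_subset_string_measure[OF Kb] Ksub] fin[OF B(2)] by simp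
  ultimately show ?thesis using that[of K] K(2) Ksub by simp
qed

text \<open>Only oscillation up to a fixed \<open>2 * \<delta>\<close> is required, so a single
  simple function \<open>\<sigma>\<close> suffices. By Markov's inequality it is
  \<open>\<delta>\<close>-close to \<open>G\<close> off a set of measure at most
  \<open>\<eta> / 2\<close>. Inside each level set of \<open>\<sigma>\<close> a compact piece is
  chosen, and the total loss is again at most \<open>\<eta> / 2\<close>. On the finite union of
  these disjoint compact pieces \<open>\<sigma>\<close> is locally constant.\<close>

lemma ae_bochner_lusin:
  assumes m: "infinite_string m" and G: "ae_bochner (string_measure m) G x"
    and B: "B \<in> sets (string_measure m)" "B \<subseteq> {a..b}" and pos: "0 < \<delta>" "0 < \<eta>"
  obtains F where "compact F" "F \<subseteq> B" "measure (string_measure m) (B - F) \<le> \<eta>"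
    "\<And>z. z \<in> F \<Longrightarrow> \<exists>\<rho>>0. \<forall>t\<in>F. \<bar>t - z\<bar> < \<rho> \<longrightarrow> norm (G t - G z) \<le> 2 * \<delta>"
proof -
  let ?M = "string_measure m"
  obtain s e where s: "\<And>i. Bochner_Integration.simple_bochner_integrable ?M (s i)"
    "\<And>i. e i \<in> borel_measurable ?M" "\<And>i. AE t in ?M. ennreal (norm (G t - s i t)) \<le> e i t"
    "(\<lambda>i. \<integral>\<^sup>+ t. e i t \<partial>?M) \<longlonglongrightarrow> 0"
    using G unfolding ae_bochner_def by blast
  have "eventually (\<lambda>i. (\<integral>\<^sup>+ t. e i t \<partial>?M) < ennreal (\<delta> * (\<eta> / 2))) sequentially"
    by (rule order_tendstoD(2)[OF s(4)]) (use pos in simp)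
  then obtain i where i: "(\<integral>\<^sup>+ t. e i t \<partial>?M) < ennreal (\<delta> * (\<eta> / 2))"
    by (auto simp: eventually_sequentially)
  define \<sigma> where "\<sigma> = s i"
  have \<sigma>: "simple_function ?M \<sigma>"
    using s(1)[of i] by (auto simp: \<sigma>_def elim: Bochner_Integration.simple_bochner_integrable.cases)
  note em[measurable] = s(2)[of i]
  obtain Z where Z: "Z \<in> null_sets ?M" "{t. \<not> ennreal (norm (G t - \<sigma> t)) \<le> e i t} \<subseteq> Z"
    using s(3)[of i] by (auto simp: eventually_ae_filter \<sigma>_def)
  define H where "H = {t \<in> space ?M. ennreal \<delta> \<le> e i t}"
  have H: "H \<in> sets ?M" unfolding H_def by measurable
  have "emeasure ?M H \<le> ennreal (\<eta> / 2)"
  proof -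
    have "ennreal \<delta> * emeasure ?M H = (\<integral>\<^sup>+ t. ennreal \<delta> * indicator H t \<partial>?M)"
      using H by (simp add: nn_integral_cmult_indicator)
    also have "\<dots> \<le> (\<integral>\<^sup>+ t. e i t \<partial>?M)"
      by (intro nn_integral_mono) (auto simp: H_def indicator_def)
    also have "\<dots> \<le> ennreal \<delta> * ennreal (\<eta> / 2)"
      using i pos by (simp add: ennreal_mult[symmetric] less_imp_le)
    finally show ?thesis using pos by (simp add: ennreal_mult_le_mult_iff)
  qed
  then have Hm: "emeasure ?M (H \<union> Z) \<le> ennreal (\<eta> / 2)"
    using emeasure_Un_null_set[OF H Z(1)] by simp
  define C where "C = B - (H \<union> Z)"
  have C: "C \<in> sets ?M" "C \<subseteq> B" using B(1) H Z(1) by (auto simp: C_def)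
  have good: "norm (G t - \<sigma> t) \<le> \<delta>" if "t \<in> C" for t
  proof -
    have "ennreal (norm (G t - \<sigma> t)) \<le> e i t" "e i t < ennreal \<delta>"
      using that Z(2) by (auto simp: C_def H_def)
    then have "ennreal (norm (G t - \<sigma> t)) \<le> ennreal \<delta>" by (rule order.strict_implies_order[OF order.strict_trans1])
    then show ?thesis using pos by (simp add: ennreal_le_iff)
  qed
  define Y where "Y = range \<sigma>"
  have fY: "finite Y" using \<sigma> by (simp add: simple_function_def Y_def)
  \<comment> \<open>Each of the \<open>card Y\<close> pieces may lose
    \<open>\<eta> / (2 * n)\<close>; the added 1 makes \<open>n\<close> evidently positive.\<close>
  define n where "n = real (card Y) + 1"
  have n: "0 < n" by (simp add: n_def)
  have "\<exists>F. compact F \<and> F \<subseteq> C \<inter> \<sigma> -` {y} \<and> measure ?M (C \<inter> \<sigma> -` {y} - F) \<le> \<eta> / (2 * n)" for y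
  proof -
    have Cy: "C \<inter> \<sigma> -` {y} \<in> sets ?M" "C \<inter> \<sigma> -` {y} \<subseteq> {a..b}"
      using C simple_functionD(2)[OF \<sigma>, of "{y}"] B(2) by auto
    have "0 < \<eta> / (2 * n)" using pos n by simp
    then show ?thesis by (rule string_measure_inner_regular[OF m Cy]) blast
  qed
  then have "\<exists>\<F>. \<forall>y. compact (\<F> y) \<and> \<F> y \<subseteq> C \<inter> \<sigma> -` {y} \<and>
      measure ?M (C \<inter> \<sigma> -` {y} - \<F> y) \<le> \<eta> / (2 * n)"
    by (intro choice allI)
  then obtain \<F> where F: "\<And>y. compact (\<F> y)" "\<And>y. \<F> y \<subseteq> C \<inter> \<sigma> -` {y}"
    "\<And>y. measure ?M (C \<inter> \<sigma> -` {y} - \<F> y) \<le> \<eta> / (2 * n)" by blast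
  define F' where "F' = (\<Union>y\<in>Y. \<F> y)"
  have cF: "compact F'" unfolding F'_def using fY F(1) by (intro compact_UN) auto
  have sF: "F' \<subseteq> C" using F(2) by (auto simp: F'_def)
  have mF: "\<F> y \<in> sets ?M" for y
    using F(1) by (intro borel_subset_string_measure) (simp add: compact_imp_closed)
  have fin: "emeasure ?M A < \<infinity>" if "A \<subseteq> {a..b}" for A
    using emeasure_string_measure_bounded[OF m that] .
  have fm: "A \<in> fmeasurable ?M" if "A \<in> sets ?M" "A \<subseteq> {a..b}" for A
    using fin[OF that(2)] that(1) by (intro fmeasurableI) auto
  have sCy: "C \<inter> \<sigma> -` {y} - \<F> y \<in> sets ?M" for y
    using C(1) simple_functionD(2)[OF \<sigma>, of "{y}"] mF by auto
  define P1 where "P1 = (H \<union> Z) \<inter> B"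
  define P2 where "P2 = (\<Union>y\<in>Y. C \<inter> \<sigma> -` {y} - \<F> y)"
  have P: "P1 \<in> sets ?M" "P2 \<in> sets ?M"
    using H Z(1) B(1) sCy fY by (auto simp: P1_def P2_def)
  have "measure ?M (B - F') \<le> measure ?M (P1 \<union> P2)"
  proof (rule measure_mono_fmeasurable)
    show "B - F' \<subseteq> P1 \<union> P2"
      by (auto simp: F'_def C_def Y_def P1_def P2_def)
    show "B - F' \<in> sets ?M" using B(1) mF fY by (auto simp: F'_def)
    show "P1 \<union> P2 \<in> fmeasurable ?M"
      by (rule fm) (use P B C(2) in \<open>auto simp: P1_def P2_def\<close>)
  qed
  also have "\<dots> \<le> measure ?M P1 + measure ?M P2"
    by (rule measure_Un_le[OF P])
  also have "\<dots> \<le> \<eta> / 2 + (\<Sum>y\<in>Y. \<eta> / (2 * n))"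
  proof (rule add_mono)
    have "emeasure ?M P1 \<le> emeasure ?M (H \<union> Z)"
      using H Z(1) by (intro emeasure_mono) (auto simp: P1_def)
    then have "emeasure ?M P1 \<le> ennreal (\<eta> / 2)" using Hm by (rule order_trans)
    then show "measure ?M P1 \<le> \<eta> / 2"
      using pos unfolding measure_def by (intro enn2real_leI) auto
    have "measure ?M P2 \<le> (\<Sum>y\<in>Y. measure ?M (C \<inter> \<sigma> -` {y} - \<F> y))"
      unfolding P2_def by (rule measure_UNION_le[OF fY]) (rule sCy)
    also have "\<dots> \<le> (\<Sum>y\<in>Y. \<eta> / (2 * n))" by (intro sum_mono F(3))
    finally show "measure ?M P2 \<le> (\<Sum>y\<in>Y. \<eta> / (2 * n))" .
  qed
  also have "\<dots> \<le> \<eta>"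
  proof -
    have "real (card Y) * (\<eta> / (2 * n)) \<le> n * (\<eta> / (2 * n))"
      using pos n by (intro mult_right_mono) (auto simp: n_def)
    also have "\<dots> = \<eta> / 2" using n by simp
    finally show ?thesis unfolding sum_constant by linarith
  qed
  finally have meas: "measure ?M (B - F') \<le> \<eta>" .
  have loc: "\<exists>\<rho>>0. \<forall>t\<in>F'. \<bar>t - z\<bar> < \<rho> \<longrightarrow> norm (G t - G z) \<le> 2 * \<delta>" if zF: "z \<in> F'" for z
  proof -
    \<comment> \<open>The pieces belonging to the other values form a closed set that misses
      \<open>z\<close>, so near \<open>z\<close> only the value \<open>\<sigma> z\<close> occurs on
      \<open>F'\<close>.\<close>
    define E where "E = (\<Union>y\<in>Y - {\<sigma> z}. \<F> y)"
    have "closed E" unfolding E_def using fY F(1) by (intro closed_UN) (auto simp: compact_imp_closed)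
    moreover have "z \<in> - E" using F(2) by (auto simp: E_def)
    ultimately obtain \<rho> where \<rho>: "0 < \<rho>" "ball z \<rho> \<subseteq> - E"
      by (meson open_Compl openE)
    have "norm (G t - G z) \<le> 2 * \<delta>" if t: "t \<in> F'" "\<bar>t - z\<bar> < \<rho>" for t
    proof -
      have "t \<in> ball z \<rho>" using t(2) by (simp add: dist_real_def abs_minus_commute)
      then have "t \<notin> E" using \<rho>(2) by blast
      then have "\<sigma> t = \<sigma> z" using t(1) F(2) by (auto simp: F'_def E_def)
      then have "G t - G z = (G t - \<sigma> t) - (G z - \<sigma> z)" by simp
      then have "norm (G t - G z) \<le> norm (G t - \<sigma> t) + norm (G z - \<sigma> z)"
        by (metis norm_triangle_ineq4)
      also have "\<dots> \<le> \<delta> + \<delta>" using good t(1) zF sF by (intro add_mono) auto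
      finally show ?thesis by simp
    qed
    then show ?thesis using \<rho>(1) by blast
  qed
  have "F' \<subseteq> B" using sF C(2) by auto
  from that[OF cF this meas loc] show ?thesis .
qed

section \<open>Second differences of weak solutions\<close>

text \<open>Twice the Green function of the negative second derivative on the interval from
  \<open>z - h\<close> to \<open>z + h\<close> with zero boundary values, with its pole at the
  centre.\<close>

definition tent :: "real \<Rightarrow> real \<Rightarrow> real \<Rightarrow> real" where
  "tent z h t = max 0 (h - \<bar>t - z\<bar>)"

lemma tent_le: "0 \<le> h \<Longrightarrow> tent z h t \<le> h * indicator {z - h..z + h} t"
  and tent_nonneg: "0 \<le> tent z h t"
  by (auto simp: tent_def indicator_def)

lemma borel_measurable_tent: "tent z h \<in> borel_measurable borel"
  unfolding tent_def[abs_def] by measurable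

lemma integrable_tent:
  assumes "infinite_string m" "0 \<le> h" shows "integrable (string_measure m) (tent z h)"
  by (rule integrable_string_measure[OF assms(1) borel_measurable_tent, of _ _ h "z - h" "z + h"])
    (use tent_le[OF assms(2)] tent_nonneg in simp)

lemma integrable_bounded_mult:
  fixes \<phi> q :: "real \<Rightarrow> real"
  assumes "integrable (string_measure m) q" "\<phi> \<in> borel_measurable borel" "\<And>t. \<bar>\<phi> t\<bar> \<le> C"
  shows "integrable (string_measure m) (\<lambda>t. \<phi> t * q t)"
proof (rule Bochner_Integration.integrable_bound)
  show "integrable (string_measure m) (\<lambda>t. C * q t)" using assms(1) by simp
  show "(\<lambda>t. \<phi> t * q t) \<in> borel_measurable (string_measure m)"
    using borel_measurable_string_measure[OF assms(2)] assms(1) by measurable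
  show "AE t in string_measure m. norm (\<phi> t * q t) \<le> norm (C * q t)"
  proof (rule AE_I2)
    fix t
    have "\<bar>\<phi> t\<bar> * \<bar>q t\<bar> \<le> \<bar>C\<bar> * \<bar>q t\<bar>"
      using assms(3)[of t] by (intro mult_right_mono) auto
    then show "norm (\<phi> t * q t) \<le> norm (C * q t)" by (simp add: abs_mult)
  qed
qed

lemma has_bochner_integral_shift:
  fixes r :: "real \<Rightarrow> real"
  assumes "has_bochner_integral lborel r 1" "r \<in> borel_measurable borel"
  shows "integrable lebesgue (\<lambda>t. r (t - s))" "(\<integral>t. r (t - s) \<partial>lebesgue) = 1"
proof -
  have "has_bochner_integral lborel (\<lambda>t. r (- s + 1 * t)) (1 /\<^sub>R \<bar>1\<bar>)"
    using assms(1) by (intro lborel_has_bochner_integral_real_affine_iff[THEN iffD1]) auto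
  then have h: "has_bochner_integral lborel (\<lambda>t. r (t - s)) 1" by simp
  have m: "(\<lambda>t. r (t - s)) \<in> borel_measurable lborel"
    using assms(2) by measurable
  show "integrable lebesgue (\<lambda>t. r (t - s))" "(\<integral>t. r (t - s) \<partial>lebesgue) = 1"
    using h m by (auto simp: integrable_completion integral_completion has_bochner_integral_iff)
qed

text \<open>Testing with a mollified \<open>tent\<close>, whose second derivative is the combination of three
  approximate point masses that produces the second difference of \<open>d\<close>.\<close>

lemma second_difference_approx:
  fixes d G :: "real \<Rightarrow> 'a::banach"
  assumes m: "infinite_string m"
    and weak: "\<And>\<xi>. test_function \<xi> \<Longrightarrow> test_function (deriv \<xi>) \<Longrightarrow>
      \<exists>I. ae_bochner (string_measure m) (\<lambda>t. indicator {0<..} t *\<^sub>R \<xi> t *\<^sub>R G t) I \<and>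
          ae_bochner lebesgue (\<lambda>t. indicator {0<..} t *\<^sub>R deriv (deriv \<xi>) t *\<^sub>R d t) I"
    and h: "0 < h" "h < z" "0 < \<epsilon>" "h + \<epsilon> < h'"
    and q: "integrable (string_measure m) q" "\<And>t. 0 \<le> q t"
    and le: "AE t in string_measure m. \<bar>t - z\<bar> < h' \<longrightarrow> norm (G t - c) \<le> q t"
    and \<eta>: "0 \<le> \<eta>" "\<And>s t. s \<in> {z - h, z, z + h} \<Longrightarrow> s \<le> t \<Longrightarrow> t \<le> s + \<epsilon> \<Longrightarrow> norm (d t - d s) \<le> \<eta>"
  shows "norm (d (z - h) + d (z + h) - 2 *\<^sub>R d z - (\<integral>t. tent z h t \<partial>string_measure m) *\<^sub>R c)
    \<le> (\<integral>t. tent z h t * q t \<partial>string_measure m) + 4 * \<eta> +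
      4 * \<epsilon> * ((\<integral>t. q t \<partial>string_measure m) + measure (string_measure m) {0..z + h'} * norm c)"
proof -
  let ?M = "string_measure m"
  obtain \<xi> r where \<xi>: "test_function \<xi>" "test_function (deriv \<xi>)"
    and dd: "\<And>t. deriv (deriv \<xi>) t = r (t - (z - h)) + r (t - (z + h)) - 2 * r (t - z)"
    and r: "continuous_on UNIV r" "\<And>x. 0 \<le> r x" "\<And>x. r x \<noteq> 0 \<Longrightarrow> 0 \<le> x \<and> x \<le> \<epsilon>"
      "has_bochner_integral lborel r 1"
    and near: "\<And>t. \<bar>\<xi> t - max 0 (h - \<bar>t - z\<bar>)\<bar> \<le> 4 * \<epsilon>"
    and supp: "\<And>t. \<xi> t \<noteq> 0 \<Longrightarrow> z - h \<le> t \<and> t \<le> z + h + \<epsilon>"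
    using exists_kernel[OF h(3,1,2)] by blast
  obtain I where I: "ae_bochner ?M (\<lambda>t. indicator {0<..} t *\<^sub>R \<xi> t *\<^sub>R G t) I"
    "ae_bochner lebesgue (\<lambda>t. indicator {0<..} t *\<^sub>R deriv (deriv \<xi>) t *\<^sub>R d t) I"
    using weak[OF \<xi>] by blast
  have "continuous_on UNIV \<xi>"
    using \<xi>(1) differentiable_imp_continuous_on[of \<xi> UNIV]
    by (metis funpow_0 test_function_def)
  then have m\<xi>: "\<xi> \<in> borel_measurable borel" by (rule borel_measurable_continuous_onI)
  note m\<xi>[measurable]
  have near': "\<bar>\<xi> t - tent z h t\<bar> \<le> 4 * \<epsilon>" for t using near by (simp add: tent_def)
  have b\<xi>: "\<bar>\<xi> t\<bar> \<le> h + 4 * \<epsilon>" for t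
  proof -
    have "tent z h t \<le> h" using h(1) by (simp add: tent_def)
    with near'[of t] tent_nonneg[of z h t] show ?thesis by linarith
  qed
  \<comment> \<open>The window contains the supports of both functions, because \<open>h < z\<close>
    and \<open>h + \<epsilon> < h'\<close>. It has finite measure, so the uniform error can be
    integrated.\<close>
  have diff_le: "\<bar>\<xi> t - tent z h t\<bar> \<le> 4 * \<epsilon> * indicator {0..z + h'} t" for t
  proof (cases "t \<in> {0..z + h'}")
    case False
    have "\<xi> t = 0"
    proof (rule ccontr)
      assume "\<xi> t \<noteq> 0"
      from supp[OF this] False h show False by auto
    qed
    moreover have "tent z h t = 0" using False h by (auto simp: tent_def)
    ultimately show ?thesis using False by simp
  qed (use near'[of t] in simp)
  have int_diff: "integrable ?M (\<lambda>t. \<xi> t - tent z h t)"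
    by (rule integrable_string_measure[OF m _ diff_le]) (use m\<xi> borel_measurable_tent in simp)
  have intt: "integrable ?M (tent z h)" using integrable_tent[OF m, of h z] h by simp
  have int\<xi>: "integrable ?M \<xi>" using Bochner_Integration.integrable_add[OF int_diff intt] by simp
  define k where "k = (\<integral>t. \<xi> t \<partial>?M)"
  define k0 where "k0 = (\<integral>t. tent z h t \<partial>?M)"
  have kk: "\<bar>k - k0\<bar> \<le> 4 * \<epsilon> * measure ?M {0..z + h'}"
  proof -
    have "k - k0 = (\<integral>t. \<xi> t - tent z h t \<partial>?M)"
      unfolding k_def k0_def by (rule Bochner_Integration.integral_diff[OF int\<xi> intt, symmetric])
    also have "\<bar>\<dots>\<bar> \<le> (\<integral>t. \<bar>\<xi> t - tent z h t\<bar> \<partial>?M)" by (rule integral_abs_bound)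
    also have "\<dots> \<le> (\<integral>t. 4 * \<epsilon> * indicator {0..z + h'} t \<partial>?M)"
      using int_diff diff_le emeasure_string_measure_bounded[OF m order_refl, of 0 "z + h'"]
      by (intro integral_mono integrable_mult_right integrable_real_indicator borel_subset_string_measure) auto
    also have "\<dots> = 4 * \<epsilon> * measure ?M {0..z + h'}"
      using emeasure_string_measure_bounded[OF m order_refl, of 0 "z + h'"]
      by (simp add: borel_subset_string_measure)
    finally show ?thesis .
  qed
  have intq: "integrable ?M (\<lambda>t. \<bar>\<xi> t\<bar> * q t)" "integrable ?M (\<lambda>t. tent z h t * q t)"
    by (rule integrable_bounded_mult[OF q(1), of _ "h + 4 * \<epsilon>"];
        use b\<xi> h tent_nonneg borel_measurable_tent in \<open>auto simp: tent_def\<close>)+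
  \<comment> \<open>First evaluation of \<open>I\<close>, on the side of the string measure:
    replacing \<open>G\<close> by \<open>c\<close> costs \<open>q\<close> weighted with
    \<open>\<xi>\<close>, which is compared with the tent.\<close>
  have A: "norm (I - k *\<^sub>R c) \<le> (\<integral>t. tent z h t * q t \<partial>?M) + 4 * \<epsilon> * (\<integral>t. q t \<partial>?M)"
  proof -
    have "ennreal (norm (I - k *\<^sub>R c)) \<le> (\<integral>\<^sup>+t. ennreal (\<bar>\<xi> t\<bar> * q t) \<partial>?M)"
    proof (rule ae_bochner_norm_le)
      show "ae_bochner ?M (\<lambda>t. indicator {0<..} t *\<^sub>R \<xi> t *\<^sub>R G t - \<xi> t *\<^sub>R c) (I - k *\<^sub>R c)"
        unfolding k_def by (intro ae_bochner_diff I ae_bochner_scaleR_const int\<xi>)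
      show "(\<lambda>t. ennreal (\<bar>\<xi> t\<bar> * q t)) \<in> borel_measurable ?M"
        using intq(1) by measurable
      show "AE t in ?M. ennreal (norm (indicator {0<..} t *\<^sub>R \<xi> t *\<^sub>R G t - \<xi> t *\<^sub>R c)) \<le> ennreal (\<bar>\<xi> t\<bar> * q t)"
        using le
      proof eventually_elim
        case (elim t)
        show ?case
        proof (cases "\<xi> t = 0")
          case False
          then have "\<bar>t - z\<bar> < h'" "0 < t" using supp[of t] h by auto
          then have "norm (\<xi> t *\<^sub>R (G t - c)) \<le> \<bar>\<xi> t\<bar> * q t"
            using elim by (simp add: mult_left_mono)
          then show ?thesis using \<open>0 < t\<close> by (simp add: scaleR_diff_right ennreal_leI)
        qed simp
      qed
    qed
    also have "\<dots> = ennreal (\<integral>t. \<bar>\<xi> t\<bar> * q t \<partial>?M)"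
      by (rule nn_integral_eq_integral[OF intq(1)]) (use q in simp)
    finally have "norm (I - k *\<^sub>R c) \<le> (\<integral>t. \<bar>\<xi> t\<bar> * q t \<partial>?M)"
      using q(2) by (simp add: ennreal_le_iff integral_nonneg_AE)
    also have "\<dots> \<le> (\<integral>t. tent z h t * q t + 4 * \<epsilon> * q t \<partial>?M)"
    proof (intro integral_mono intq(1) Bochner_Integration.integrable_add intq(2) integrable_mult_right q(1))
      fix t
      have "\<bar>\<xi> t\<bar> \<le> tent z h t + 4 * \<epsilon>" using near'[of t] tent_nonneg[of z h t] by linarith
      from mult_right_mono[OF this q(2)]
      show "\<bar>\<xi> t\<bar> * q t \<le> tent z h t * q t + 4 * \<epsilon> * q t" by (simp add: distrib_right)
    qed
    also have "\<dots> = (\<integral>t. tent z h t * q t \<partial>?M) + 4 * \<epsilon> * (\<integral>t. q t \<partial>?M)"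
      using intq(2) q(1) by simp
    finally show ?thesis .
  qed
  have mr: "r \<in> borel_measurable borel" using r(1) by (rule borel_measurable_continuous_onI)
  note shift = has_bochner_integral_shift[OF r(4) mr]
  \<comment> \<open>Second evaluation of \<open>I\<close>, on the Lebesgue side: each copy of
    \<open>r\<close> has mass 1 within \<open>\<epsilon>\<close> to the right of its centre
    \<open>s\<close>, so \<open>d t\<close> may be replaced by \<open>d s\<close> at cost
    \<open>\<eta>\<close>. The weights add up to 4.\<close>
  have B: "norm (I - (d (z - h) + d (z + h) - 2 *\<^sub>R d z)) \<le> 4 * \<eta>"
  proof -
    let ?f = "\<lambda>t. r (t - (z - h)) *\<^sub>R d (z - h) + r (t - (z + h)) *\<^sub>R d (z + h) - r (t - z) *\<^sub>R (2 *\<^sub>R d z)"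
    let ?g = "\<lambda>t. (r (t - (z - h)) + r (t - (z + h)) + r (t - z) * 2) * \<eta>"
    have ig: "integrable lebesgue ?g" "(\<integral>t. ?g t \<partial>lebesgue) = 4 * \<eta>"
      by (simp_all add: shift)
    have pt: "ae_bochner lebesgue (\<lambda>t. r (t - s) *\<^sub>R v) (1 *\<^sub>R v)" for s v
      using ae_bochner_scaleR_const[OF shift(1), of s v] by (simp only: shift(2))
    have f: "ae_bochner lebesgue ?f (1 *\<^sub>R d (z - h) + 1 *\<^sub>R d (z + h) - 1 *\<^sub>R (2 *\<^sub>R d z))"
      by (intro ae_bochner_diff ae_bochner_add pt)
    have one: "norm (indicator {0<..} t *\<^sub>R r (t - s) *\<^sub>R d t - r (t - s) *\<^sub>R d s) \<le> r (t - s) * \<eta>"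
      if s: "s \<in> {z - h, z, z + h}" for s t
    proof (cases "r (t - s) = 0")
      case False
      then have st: "s \<le> t" "t \<le> s + \<epsilon>" using r(3)[of "t - s"] by auto
      then have "0 < t" using s h by auto
      have "norm (r (t - s) *\<^sub>R (d t - d s)) \<le> r (t - s) * \<eta>"
        using \<eta>(2)[OF s st] r(2)[of "t - s"] by (simp add: mult_left_mono)
      then show ?thesis using \<open>0 < t\<close> by (simp add: scaleR_diff_right)
    qed (use \<eta>(1) in simp)
    have "ennreal (norm (I - (1 *\<^sub>R d (z - h) + 1 *\<^sub>R d (z + h) - 1 *\<^sub>R (2 *\<^sub>R d z)))) \<le> (\<integral>\<^sup>+t. ennreal (?g t) \<partial>lebesgue)"
    proof (rule ae_bochner_norm_le[OF ae_bochner_diff[OF I(2) f]])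
      show "(\<lambda>t. ennreal (?g t)) \<in> borel_measurable lebesgue" using ig(1) by measurable
      show "AE t in lebesgue. ennreal (norm (indicator {0<..} t *\<^sub>R deriv (deriv \<xi>) t *\<^sub>R d t - ?f t)) \<le> ennreal (?g t)"
      proof (intro AE_I2 ennreal_leI)
        fix t :: real
        define D where "D s = indicator {0<..} t *\<^sub>R r (t - s) *\<^sub>R d t - r (t - s) *\<^sub>R d s" for s
        have "indicator {0<..} t *\<^sub>R deriv (deriv \<xi>) t *\<^sub>R d t - ?f t = D (z - h) + D (z + h) - 2 *\<^sub>R D z"
          by (simp add: D_def dd algebra_simps)
        also have "norm \<dots> \<le> norm (D (z - h)) + norm (D (z + h)) + 2 * norm (D z)"
          by (intro order_trans[OF norm_triangle_ineq4] add_mono norm_triangle_ineq) simp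
        also have "\<dots> \<le> r (t - (z - h)) * \<eta> + r (t - (z + h)) * \<eta> + 2 * (r (t - z) * \<eta>)"
          unfolding D_def by (intro add_mono mult_left_mono one) auto
        also have "\<dots> = ?g t" by (simp add: algebra_simps)
        finally show "norm (indicator {0<..} t *\<^sub>R deriv (deriv \<xi>) t *\<^sub>R d t - ?f t) \<le> ?g t" .
      qed
    qed
    also have "\<dots> = ennreal (4 * \<eta>)"
      unfolding ig(2)[symmetric] by (rule nn_integral_eq_integral[OF ig(1)]) (use r(2) \<eta>(1) in simp)
    finally show ?thesis using \<eta>(1) by simp
  qed
  have "d (z - h) + d (z + h) - 2 *\<^sub>R d z - k0 *\<^sub>R c
      = (I - k *\<^sub>R c) - (I - (d (z - h) + d (z + h) - 2 *\<^sub>R d z)) + (k - k0) *\<^sub>R c"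
    by (simp add: scaleR_diff_left)
  also have "norm \<dots> \<le> norm (I - k *\<^sub>R c) + norm (I - (d (z - h) + d (z + h) - 2 *\<^sub>R d z)) + \<bar>k - k0\<bar> * norm c"
    by (intro order_trans[OF norm_triangle_ineq] add_mono norm_triangle_ineq4) simp
  also have "\<dots> \<le> ((\<integral>t. tent z h t * q t \<partial>?M) + 4 * \<epsilon> * (\<integral>t. q t \<partial>?M)) + 4 * \<eta>
      + (4 * \<epsilon> * measure ?M {0..z + h'}) * norm c"
    by (intro add_mono A B mult_right_mono kk) simp
  finally show ?thesis by (simp add: k0_def algebra_simps)
qed

text \<open>Limit of the previous estimate as the mollification width tends to 0. The gap between
  \<open>h\<close> and \<open>h'\<close> leaves room for the part of the mollified tent that sticks
  out beyond \<open>z + h\<close>.\<close>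

lemma second_difference_le:
  fixes d G :: "real \<Rightarrow> 'a::banach"
  assumes m: "infinite_string m" and d: "continuous_on {0..} d"
    and weak: "\<And>\<xi>. test_function \<xi> \<Longrightarrow> test_function (deriv \<xi>) \<Longrightarrow>
      \<exists>I. ae_bochner (string_measure m) (\<lambda>t. indicator {0<..} t *\<^sub>R \<xi> t *\<^sub>R G t) I \<and>
          ae_bochner lebesgue (\<lambda>t. indicator {0<..} t *\<^sub>R deriv (deriv \<xi>) t *\<^sub>R d t) I"
    and h: "0 < h" "h < z" "h < h'"
    and q: "integrable (string_measure m) q" "\<And>t. 0 \<le> q t"
    and le: "AE t in string_measure m. \<bar>t - z\<bar> < h' \<longrightarrow> norm (G t - c) \<le> q t"
  shows "norm (d (z - h) + d (z + h) - 2 *\<^sub>R d z - (\<integral>t. tent z h t \<partial>string_measure m) *\<^sub>R c)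
    \<le> (\<integral>t. tent z h t * q t \<partial>string_measure m)"
proof (rule field_le_epsilon)
  fix \<tau> :: real assume "0 < \<tau>"
  define C where "C = (\<integral>t. q t \<partial>string_measure m) + measure (string_measure m) {0..z + h'} * norm c"
  have C: "0 \<le> C" unfolding C_def using q(2) by (intro add_nonneg_nonneg integral_nonneg_AE) auto
  have "\<exists>e>0. \<forall>t. s \<le> t \<longrightarrow> t \<le> s + e \<longrightarrow> norm (d t - d s) \<le> \<tau> / 8" if s0: "0 \<le> s" for s
  proof -
    obtain e where "0 < e" "\<And>t. t \<in> {0..} \<Longrightarrow> dist t s < e \<Longrightarrow> dist (d t) (d s) < \<tau> / 8"
      using d[unfolded continuous_on_iff, rule_format, of s "\<tau> / 8"] s0 \<open>0 < \<tau>\<close> by auto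
    then have "norm (d t - d s) \<le> \<tau> / 8" if "s \<le> t" "t \<le> s + e / 2" for t
      using that \<open>0 < e\<close> s0 by (simp add: dist_norm less_imp_le)
    then show ?thesis using \<open>0 < e\<close> by (intro exI[of _ "e / 2"]) auto
  qed
  then obtain e where e: "\<And>s. 0 \<le> s \<Longrightarrow> 0 < e s"
    "\<And>s t. 0 \<le> s \<Longrightarrow> s \<le> t \<Longrightarrow> t \<le> s + e s \<Longrightarrow> norm (d t - d s) \<le> \<tau> / 8" by metis
  \<comment> \<open>Half of \<open>\<tau>\<close> pays for the continuity error
    \<open>4 * (\<tau> / 8)\<close>, the other half for \<open>4 * \<epsilon> * C\<close>. The
    denominator uses \<open>C + 1\<close> because \<open>C\<close> may be 0.\<close>
  define \<epsilon> where "\<epsilon> = Min {e (z - h), e z, e (z + h), (h' - h) / 2, \<tau> / (8 * (C + 1))}"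
  have \<epsilon>0: "0 < \<epsilon>"
    unfolding \<epsilon>_def using e(1)[of z] e(1)[of "z - h"] e(1)[of "z + h"] h C \<open>0 < \<tau>\<close> by auto
  have \<epsilon>: "0 < \<epsilon>" "\<epsilon> \<le> e (z - h)" "\<epsilon> \<le> e z" "\<epsilon> \<le> e (z + h)" "\<epsilon> \<le> (h' - h) / 2" "\<epsilon> \<le> \<tau> / (8 * (C + 1))"
    by (fact \<epsilon>0, unfold \<epsilon>_def, (rule Min_le; simp)+)
  have d1: "norm (d t - d s) \<le> \<tau> / 8" if "s \<in> {z - h, z, z + h}" "s \<le> t" "t \<le> s + \<epsilon>" for s t
    by (rule e(2)) (use that \<epsilon> h in auto)
  have "h + \<epsilon> < h'" using \<epsilon>(5) h(3) by (simp add: field_simps)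
  from second_difference_approx[OF m weak h(1,2) \<epsilon>(1) this q le _ d1]
  have "norm (d (z - h) + d (z + h) - 2 *\<^sub>R d z - (\<integral>t. tent z h t \<partial>string_measure m) *\<^sub>R c)
      \<le> (\<integral>t. tent z h t * q t \<partial>string_measure m) + 4 * (\<tau> / 8) + 4 * \<epsilon> * C"
    using \<open>0 < \<tau>\<close> unfolding C_def by simp
  moreover have "4 * \<epsilon> * C \<le> \<tau> / 2"
  proof -
    have "8 * (\<epsilon> * (C + 1)) \<le> \<tau>" using \<epsilon>(6) C by (simp add: field_simps)
    moreover have "\<epsilon> * C \<le> \<epsilon> * (C + 1)" using \<epsilon>(1) by simp
    ultimately show ?thesis by linarith
  qed
  ultimately show "norm (d (z - h) + d (z + h) - 2 *\<^sub>R d z - (\<integral>t. tent z h t \<partial>string_measure m) *\<^sub>R c)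
      \<le> (\<integral>t. tent z h t * q t \<partial>string_measure m) + \<tau>"
    by linarith
qed

section \<open>The maximum principle\<close>

text \<open>The real function \<open>potential m R q\<close> solves \<open>d/dm d/dz = q\<close> on \<open>[0,R]\<close>; adding it to the norm of
  a solution compensates the error terms.\<close>

definition potential :: "(real \<Rightarrow> real) \<Rightarrow> real \<Rightarrow> (real \<Rightarrow> real) \<Rightarrow> real \<Rightarrow> real" where
  "potential m R q z = (\<integral>t. (indicator {0..R} t * \<bar>z - t\<bar> / 2) * q t \<partial>string_measure m)"

lemma integrable_potential:
  assumes q: "integrable (string_measure m) q"
  shows "integrable (string_measure m) (\<lambda>t. (indicator {0..R} t * \<bar>z - t\<bar> / 2) * q t)"
  by (rule integrable_bounded_mult[OF q, of _ "\<bar>z\<bar> + \<bar>R\<bar>"]) (auto simp: indicator_def)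

text \<open>The identity holds for the kernels at each \<open>t\<close>: the second difference of
  \<bar>z - t\<bar> / 2 in \<open>z\<close> is the tent. The tent vanishes outside
  \<open>{0..R}\<close> because \<open>z - h\<close> and \<open>z + h\<close> stay in that interval,
  so the cutoff does no harm.\<close>

lemma potential_second_difference:
  assumes q: "integrable (string_measure m) q" and R: "0 \<le> z - h" "z + h \<le> R" "0 < h"
  shows "potential m R q (z - h) + potential m R q (z + h) - 2 * potential m R q z
    = (\<integral>t. tent z h t * q t \<partial>string_measure m)"
proof -
  let ?M = "string_measure m"
  note i = integrable_potential[OF q, of R]
  have "(\<integral>t. tent z h t * q t \<partial>?M) =
    (\<integral>t. (indicator {0..R} t * \<bar>z - h - t\<bar> / 2) * q t + (indicator {0..R} t * \<bar>z + h - t\<bar> / 2) * q t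
      - 2 * ((indicator {0..R} t * \<bar>z - t\<bar> / 2) * q t) \<partial>?M)"
  proof (rule Bochner_Integration.integral_cong[OF refl])
    fix t
    have "tent z h t = indicator {0..R} t * \<bar>z - h - t\<bar> / 2 + indicator {0..R} t * \<bar>z + h - t\<bar> / 2
      - 2 * (indicator {0..R} t * \<bar>z - t\<bar> / 2)"
      using R by (auto simp: tent_def indicator_def max_def abs_if field_simps)
    then show "tent z h t * q t = (indicator {0..R} t * \<bar>z - h - t\<bar> / 2) * q t + (indicator {0..R} t * \<bar>z + h - t\<bar> / 2) * q t
      - 2 * ((indicator {0..R} t * \<bar>z - t\<bar> / 2) * q t)"
      by (simp only: left_diff_distrib distrib_right mult.assoc)
  qed
  also have "\<dots> = potential m R q (z - h) + potential m R q (z + h) - 2 * potential m R q z"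
    unfolding potential_def
    by (simp only: Bochner_Integration.integral_diff[OF Bochner_Integration.integrable_add[OF i i] integrable_mult_right[OF i]]
        Bochner_Integration.integral_add[OF i i] integral_mult_right_zero)
  finally show ?thesis by simp
qed

lemma potential_bounds:
  assumes q: "integrable (string_measure m) q" "\<And>t. 0 \<le> q t" and z: "0 \<le> z" "z \<le> R"
  shows "0 \<le> potential m R q z" "potential m R q z \<le> R / 2 * (\<integral>t. q t \<partial>string_measure m)"
proof -
  show "0 \<le> potential m R q z"
    unfolding potential_def by (intro integral_nonneg_AE AE_I2 mult_nonneg_nonneg q(2)) auto
  have "potential m R q z \<le> (\<integral>t. R / 2 * q t \<partial>string_measure m)"
    unfolding potential_def
  proof (rule integral_mono[OF integrable_potential[OF q(1)]])
    show "integrable (string_measure m) (\<lambda>t. R / 2 * q t)" using q(1) by simp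
    fix t
    show "indicator {0..R} t * \<bar>z - t\<bar> / 2 * q t \<le> R / 2 * q t"
      using z by (intro mult_right_mono q(2)) (auto simp: indicator_def)
  qed
  then show "potential m R q z \<le> R / 2 * (\<integral>t. q t \<partial>string_measure m)" by simp
qed

text \<open>The kernel is Lipschitz in \<open>z\<close> uniformly in \<open>t\<close>, which makes
  the potential Lipschitz with the integral of \<bar>q\<bar> as a constant.\<close>

lemma continuous_on_potential:
  assumes q: "integrable (string_measure m) q"
  shows "continuous_on S (potential m R q)"
proof (rule lipschitz_on_continuous_on, rule lipschitz_onI)
  let ?M = "string_measure m"
  show "0 \<le> (\<integral>t. \<bar>q t\<bar> \<partial>?M)" by simp
  fix x y :: real
  note i = integrable_potential[OF q, of R]
  have eq: "potential m R q x - potential m R q y =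
    (\<integral>t. (indicator {0..R} t * \<bar>x - t\<bar> / 2) * q t - (indicator {0..R} t * \<bar>y - t\<bar> / 2) * q t \<partial>?M)"
    unfolding potential_def by (rule Bochner_Integration.integral_diff[OF i i, symmetric])
  have "\<bar>potential m R q x - potential m R q y\<bar> \<le>
    (\<integral>t. \<bar>(indicator {0..R} t * \<bar>x - t\<bar> / 2) * q t - (indicator {0..R} t * \<bar>y - t\<bar> / 2) * q t\<bar> \<partial>?M)"
    unfolding eq by (rule integral_abs_bound)
  also have "\<dots> \<le> (\<integral>t. \<bar>x - y\<bar> * \<bar>q t\<bar> \<partial>?M)"
  proof (rule integral_mono)
    show "integrable ?M (\<lambda>t. \<bar>(indicator {0..R} t * \<bar>x - t\<bar> / 2) * q t - (indicator {0..R} t * \<bar>y - t\<bar> / 2) * q t\<bar>)"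
      by (rule integrable_abs[OF Bochner_Integration.integrable_diff[OF i i]])
    show "integrable ?M (\<lambda>t. \<bar>x - y\<bar> * \<bar>q t\<bar>)" using q by simp
    fix t
    have "\<bar>(indicator {0..R} t * \<bar>x - t\<bar> / 2) * q t - (indicator {0..R} t * \<bar>y - t\<bar> / 2) * q t\<bar>
        = \<bar>indicator {0..R} t * \<bar>x - t\<bar> / 2 - indicator {0..R} t * \<bar>y - t\<bar> / 2\<bar> * \<bar>q t\<bar>"
      unfolding left_diff_distrib[symmetric] abs_mult ..
    also have "\<dots> \<le> \<bar>x - y\<bar> * \<bar>q t\<bar>"
    proof (rule mult_right_mono)
      have "\<bar>\<bar>x - t\<bar> / 2 - \<bar>y - t\<bar> / 2\<bar> = \<bar>\<bar>x - t\<bar> - \<bar>y - t\<bar>\<bar> / 2"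
        unfolding diff_divide_distrib[symmetric] abs_divide by simp
      also have "\<dots> \<le> \<bar>\<bar>x - t\<bar> - \<bar>y - t\<bar>\<bar>" by simp
      also have "\<dots> \<le> \<bar>x - y\<bar>"
        using abs_triangle_ineq3[of "x - t" "y - t"] by simp
      finally have "\<bar>\<bar>x - t\<bar> / 2 - \<bar>y - t\<bar> / 2\<bar> \<le> \<bar>x - y\<bar>" .
      then show "\<bar>indicator {0..R} t * \<bar>x - t\<bar> / 2 - indicator {0..R} t * \<bar>y - t\<bar> / 2\<bar> \<le> \<bar>x - y\<bar>"
        by (cases "t \<in> {0..R}") simp_all
    qed simp
    finally show "\<bar>(indicator {0..R} t * \<bar>x - t\<bar> / 2) * q t - (indicator {0..R} t * \<bar>y - t\<bar> / 2) * q t\<bar> \<le> \<bar>x - y\<bar> * \<bar>q t\<bar>" .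
  qed
  finally show "dist (potential m R q x) (potential m R q y) \<le> (\<integral>t. \<bar>q t\<bar> \<partial>?M) * dist x y"
    by (simp add: dist_real_def mult.commute)
qed

section \<open>The estimate on a bounded interval\<close>

lemma integral_tail_small:
  fixes b :: "'s \<Rightarrow> real"
  assumes b: "integrable M b" "\<And>t. 0 \<le> b t" and "0 < \<tau>"
  obtains L where "0 < L" "(\<integral>t. b t * indicator {t. L < b t} t \<partial>M) \<le> \<tau>"
proof -
  have [measurable]: "b \<in> borel_measurable M" using b(1) by simp
  have "(\<lambda>n. \<integral>t. (if real n < b t then b t else 0) \<partial>M) \<longlonglongrightarrow> (\<integral>t. 0 \<partial>M)"
  proof (rule integral_dominated_convergence[OF _ _ b(1)])
    show "AE t in M. (\<lambda>n. if real n < b t then b t else 0) \<longlonglongrightarrow> 0"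
    proof (rule AE_I2)
      fix t
      obtain n0 where n0: "b t < real n0" using reals_Archimedean2 by blast
      have "eventually (\<lambda>n. (if real n < b t then b t else 0) = 0) sequentially"
        unfolding eventually_sequentially
        by (rule exI[of _ n0]) (use n0 in auto)
      then show "(\<lambda>n. if real n < b t then b t else 0) \<longlonglongrightarrow> 0"
        by (rule tendsto_eventually)
    qed
    show "AE t in M. norm (if real n < b t then b t else 0) \<le> b t" for n
      using b(2) by (intro AE_I2) auto
  qed measurable
  then have "eventually (\<lambda>n. (\<integral>t. (if real n < b t then b t else 0) \<partial>M) < \<tau>) sequentially"
    using \<open>0 < \<tau>\<close> by (intro order_tendstoD(2)) auto
  then obtain n0 where n0: "\<And>n. n \<ge> n0 \<Longrightarrow> (\<integral>t. (if real n < b t then b t else 0) \<partial>M) < \<tau>"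
    by (auto simp: eventually_sequentially)
  \<comment> \<open>The successor makes the threshold \<open>L\<close> positive.\<close>
  have lt: "(\<integral>t. (if real (Suc n0) < b t then b t else 0) \<partial>M) < \<tau>" by (rule n0) simp
  have "(\<integral>t. b t * indicator {t. real (Suc n0) < b t} t \<partial>M) \<le> \<tau>"
  proof -
    have "(\<lambda>t. b t * indicator {t. real (Suc n0) < b t} t) = (\<lambda>t. if real (Suc n0) < b t then b t else 0)"
      by (auto simp: fun_eq_iff)
    then show ?thesis using lt by simp
  qed
  then show ?thesis by (intro that[of "real (Suc n0)"]) auto
qed

lemma norm_solution_bound:
  fixes d G :: "real \<Rightarrow> 'a::banach"
  assumes m: "infinite_string m" and d: "continuous_on {0..} d" "d 0 = 0"
    and weak: "\<And>\<xi>. test_function \<xi> \<Longrightarrow> test_function (deriv \<xi>) \<Longrightarrow>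
      \<exists>I. ae_bochner (string_measure m) (\<lambda>t. indicator {0<..} t *\<^sub>R \<xi> t *\<^sub>R G t) I \<and>
          ae_bochner lebesgue (\<lambda>t. indicator {0<..} t *\<^sub>R deriv (deriv \<xi>) t *\<^sub>R d t) I"
    and G: "ae_bochner (string_measure m) (\<lambda>t. indicator {0..R} t *\<^sub>R G t) x"
    and b: "integrable (string_measure m) b" "\<And>t. 0 \<le> b t" "\<And>t. t \<in> {0..R} \<Longrightarrow> norm (G t) \<le> b t"
    and acc: "AE z in string_measure m. 0 < z \<longrightarrow> (\<forall>l\<ge>0. norm (d z) \<le> norm (d z + l *\<^sub>R G z))"
    and R: "0 < R" and \<tau>: "0 < \<tau>" and a: "0 \<le> a" "a \<le> R"
  shows "norm (d a) \<le> norm (d R) * (a / R) + 2 * \<tau>"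
proof -
  let ?M = "string_measure m"
  have bm[measurable]: "b \<in> borel_measurable ?M" using b(1) by simp
  \<comment> \<open>The integral of \<open>q\<close> will be at most \<open>4 * \<kappa>\<close>, so
    the potential is at most \<open>R / 2 * (4 * \<kappa>) = \<tau>\<close>.\<close>
  define \<kappa> where "\<kappa> = \<tau> / (2 * R)"
  have \<kappa>: "0 < \<kappa>" using \<tau> R by (simp add: \<kappa>_def)
  obtain L where L: "0 < L" "(\<integral>t. b t * indicator {t. L < b t} t \<partial>?M) \<le> \<kappa>"
    using integral_tail_small[OF b(1,2) \<kappa>] by blast
  define N where "N = measure ?M {0..R} + 1"
  have N: "0 < N" using measure_nonneg[of ?M "{0..R}"] unfolding N_def by linarith
  define \<delta> where "\<delta> = \<kappa> / (2 * N)"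
  from N have \<delta>: "0 < \<delta>" using \<kappa> by (simp add: \<delta>_def)
  obtain Z where Z: "Z \<in> null_sets ?M"
    "{z. \<not> (0 < z \<longrightarrow> (\<forall>l\<ge>0. norm (d z) \<le> norm (d z + l *\<^sub>R G z)))} \<subseteq> Z"
    using acc by (auto simp: eventually_ae_filter)
  have K: "{0..R} \<in> sets ?M" by (intro borel_subset_string_measure) auto
  have bL: "{t. L < b t} \<in> sets ?M"
    using measurable_sets[OF bm, of "{L<..}"] by (simp add: vimage_def)
  \<comment> \<open>The good points: \<open>G\<close> is bounded by \<open>L\<close> and the
    accretivity inequality holds.\<close>
  define B where "B = {0..R} - {t. L < b t} - Z"
  have B: "B \<in> sets ?M" "B \<subseteq> {0..R}" using K bL Z(1) by (auto simp: B_def)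
  have "0 < \<kappa> / (2 * L)" using \<kappa> L by simp
  from ae_bochner_lusin[OF m G B \<delta> this] obtain F where F: "compact F" "F \<subseteq> B"
    "measure ?M (B - F) \<le> \<kappa> / (2 * L)"
    and loc: "\<And>z. z \<in> F \<Longrightarrow> \<exists>\<rho>>0. \<forall>t\<in>F. \<bar>t - z\<bar> < \<rho> \<longrightarrow>
      norm (indicator {0..R} t *\<^sub>R G t - indicator {0..R} z *\<^sub>R G z) \<le> 2 * \<delta>" by blast
  have FM: "F \<in> sets ?M" using F(1) by (intro borel_subset_string_measure) (simp add: compact_imp_closed)
  define U where "U = {0..R} - F"
  have UM: "U \<in> sets ?M" using K FM by (simp add: U_def)
  \<comment> \<open>For \<open>z\<close> in \<open>F\<close> the error at \<open>t\<close> is at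
    most \<open>2 * \<delta>\<close> if \<open>t\<close> is in \<open>F\<close>, and at most
    \<open>norm (G t) + norm (G z) \<le> b t + L\<close> otherwise. For \<open>z\<close> outside
    \<open>F\<close> the error is \<open>norm (G t)\<close> itself, which \<open>b t\<close> covers
    on \<open>U\<close>.\<close>
  define q where "q t = b t * indicator U t + L * indicator U t + 2 * \<delta> * indicator {0..R} t" for t
  have fin: "emeasure ?M S < \<infinity>" if "S \<subseteq> {0..R}" for S
    using emeasure_string_measure_bounded[OF m that] .
  have ind: "integrable ?M (\<lambda>t. indicator S t :: real)" if "S \<in> sets ?M" "S \<subseteq> {0..R}" for S
    using fin[OF that(2)] that(1) by (intro integrable_real_indicator)
  have Usub: "U \<subseteq> {0..R}" by (auto simp: U_def)
  have qi: "integrable ?M q"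
    unfolding q_def[abs_def]
    by (intro Bochner_Integration.integrable_add integrable_mult_right ind UM K order_refl Usub
        integrable_real_mult_indicator b(1))
  have q0: "0 \<le> q t" for t using b(2)[of t] L(1) \<delta> by (simp add: q_def)
  \<comment> \<open>Where \<open>b\<close> exceeds \<open>L\<close>, the sum \<open>b + L\<close> is
    at most \<open>2 * b\<close>, with integral at most \<open>2 * \<kappa>\<close>. On
    \<open>B - F\<close> it is at most \<open>2 * L\<close>, on a set of measure at most
    \<open>\<kappa> / (2 * L)\<close>. The constant term contributes at most
    \<open>2 * \<delta> * N = \<kappa>\<close>.\<close>
  have qint: "(\<integral>t. q t \<partial>?M) \<le> 4 * \<kappa>"
  proof -
    have BFM: "B - F \<in> sets ?M" "B - F \<subseteq> {0..R}" using B FM by auto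
    have "(\<integral>t. q t \<partial>?M) \<le> (\<integral>t. 2 * (b t * indicator {t. L < b t} t) + 2 * L * indicator (B - F) t + 2 * \<delta> * indicator {0..R} t \<partial>?M)"
    proof (rule integral_mono_AE[OF qi])
      show "integrable ?M (\<lambda>t. 2 * (b t * indicator {t. L < b t} t) + 2 * L * indicator (B - F) t + 2 * \<delta> * indicator {0..R} t)"
        by (intro Bochner_Integration.integrable_add integrable_mult_right ind BFM K order_refl
            integrable_real_mult_indicator b(1) bL)
      show "AE t in ?M. q t \<le> 2 * (b t * indicator {t. L < b t} t) + 2 * L * indicator (B - F) t + 2 * \<delta> * indicator {0..R} t"
        using AE_not_in[OF Z(1)]
      proof eventually_elim
        case (elim t)
        consider "t \<notin> U" | "t \<in> U" "L < b t" | "t \<in> U" "b t \<le> L" by linarith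
        then show ?case
        proof cases
          case 1 then show ?thesis using b(2)[of t] L(1) \<delta> by (simp add: q_def)
        next
          case 2 then show ?thesis using L(1) by (simp add: q_def indicator_def)
        next
          case 3
          then have "t \<in> B - F" using elim by (auto simp: U_def B_def)
          then show ?thesis using 3 by (simp add: q_def)
        qed
      qed
    qed
    also have "\<dots> = 2 * (\<integral>t. b t * indicator {t. L < b t} t \<partial>?M) + 2 * L * measure ?M (B - F) + 2 * \<delta> * measure ?M {0..R}"
      using ind[OF BFM] ind[OF K order_refl] integrable_real_mult_indicator[OF bL b(1)] BFM(1) K by simp
    also have "\<dots> \<le> 2 * \<kappa> + \<kappa> + \<kappa>"
    proof (intro add_mono)
      show "2 * L * measure ?M (B - F) \<le> \<kappa>"
        using F(3) L(1) by (simp add: field_simps)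
      have "2 * \<delta> * measure ?M {0..R} \<le> 2 * \<delta> * N" using \<delta> by (simp add: N_def)
      also have "\<dots> = \<kappa>" using N by (simp add: \<delta>_def)
      finally show "2 * \<delta> * measure ?M {0..R} \<le> \<kappa>" .
    qed (use L(2) in simp)
    finally show ?thesis by simp
  qed
  define T where "T = potential m R q"
  have T: "0 \<le> T z" "T z \<le> \<tau>" if z: "0 \<le> z" "z \<le> R" for z
  proof -
    show "0 \<le> T z" unfolding T_def by (rule potential_bounds[OF qi q0 z])
    have "T z \<le> R / 2 * (\<integral>t. q t \<partial>?M)" unfolding T_def by (rule potential_bounds[OF qi q0 z])
    also have "\<dots> \<le> R / 2 * (4 * \<kappa>)" using qint R by (intro mult_left_mono) auto
    also have "\<dots> = \<tau>" using R by (simp add: \<kappa>_def)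
    finally show "T z \<le> \<tau>" .
  qed
  define Q where "Q z = norm (d z) + T z" for z
  have cQ: "continuous_on {0..R} Q"
    unfolding Q_def T_def
    by (intro continuous_intros continuous_on_potential qi continuous_on_subset[OF d(1)]) auto
  have mid: "\<exists>h>0. h \<le> z \<and> z + h \<le> R \<and> 2 * Q z \<le> Q (z - h) + Q (z + h)" if z: "0 < z" "z < R" for z
  proof -
    \<comment> \<open>Take \<open>c = G z\<close> on \<open>F\<close>. Outside \<open>F\<close>, a
      whole neighbourhood of \<open>z\<close> misses this closed set, and \<open>c = 0\<close>
      works.\<close>
    have "\<exists>c \<rho>. 0 < \<rho> \<and> (\<forall>t\<in>{0..R}. \<bar>t - z\<bar> < \<rho> \<longrightarrow> norm (G t - c) \<le> q t) \<and>
      (\<forall>l\<ge>0. norm (d z) \<le> norm (d z + l *\<^sub>R c))"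
    proof (cases "z \<in> F")
      case True
      obtain \<rho> where \<rho>: "0 < \<rho>" "\<And>t. t \<in> F \<Longrightarrow> \<bar>t - z\<bar> < \<rho> \<Longrightarrow>
          norm (indicator {0..R} t *\<^sub>R G t - indicator {0..R} z *\<^sub>R G z) \<le> 2 * \<delta>"
        using loc[OF True] by blast
      have zB: "b z \<le> L" "z \<notin> Z" using True F(2) by (auto simp: B_def)
      have "norm (G t - G z) \<le> q t" if t: "t \<in> {0..R}" "\<bar>t - z\<bar> < \<rho>" for t
      proof (cases "t \<in> F")
        case True
        then show ?thesis using \<rho>(2)[OF True t(2)] t(1) z by (simp add: q_def U_def)
      next
        case False
        have "norm (G t - G z) \<le> norm (G t) + norm (G z)" by (rule norm_triangle_ineq4)
        also have "\<dots> \<le> b t + L" using b(3)[OF t(1)] b(3)[of z] zB z by auto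
        also have "\<dots> \<le> q t" using False t(1) \<delta> by (simp add: q_def U_def)
        finally show ?thesis .
      qed
      moreover have "\<forall>l\<ge>0. norm (d z) \<le> norm (d z + l *\<^sub>R G z)" using Z(2) zB(2) z by blast
      ultimately show ?thesis using \<rho>(1) by blast
    next
      case False
      have "open (- F)" using F(1) by (simp add: compact_imp_closed open_Compl)
      with False obtain \<rho> where \<rho>: "0 < \<rho>" "ball z \<rho> \<subseteq> - F" by (meson ComplI openE)
      have "norm (G t - 0) \<le> q t" if t: "t \<in> {0..R}" "\<bar>t - z\<bar> < \<rho>" for t
      proof -
        have "t \<in> ball z \<rho>" using t(2) by (simp add: dist_real_def abs_minus_commute)
        then have "t \<in> U" using \<rho>(2) t(1) by (auto simp: U_def)
        then show ?thesis using b(3)[OF t(1)] L(1) \<delta> t(1) by (simp add: q_def)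
      qed
      then show ?thesis using \<rho>(1) by (intro exI[of _ 0] exI[of _ \<rho>]) auto
    qed
    then obtain c \<rho> where \<rho>: "0 < \<rho>" "\<And>t. t \<in> {0..R} \<Longrightarrow> \<bar>t - z\<bar> < \<rho> \<Longrightarrow> norm (G t - c) \<le> q t"
      and c: "\<And>l. 0 \<le> l \<Longrightarrow> norm (d z) \<le> norm (d z + l *\<^sub>R c)" by blast
    \<comment> \<open>Keeps the window around \<open>z\<close> inside \<open>{0..R}\<close>, where
      \<open>q\<close> controls the error; halving it gives the strict gap between \<open>h\<close>
      and \<open>h'\<close>.\<close>
    define h' where "h' = min \<rho> (min z (R - z))"
    define h where "h = h' / 2"
    have h'0: "0 < h'" "h' \<le> z" "h' \<le> R - z" "h' \<le> \<rho>" using \<rho>(1) z by (auto simp: h'_def)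
    have h: "0 < h" "h < z" "h < h'" "h \<le> z" "z + h \<le> R" using h'0 by (auto simp: h_def)
    have "AE t in ?M. \<bar>t - z\<bar> < h' \<longrightarrow> norm (G t - c) \<le> q t"
    proof (intro AE_I2 impI)
      fix t assume "\<bar>t - z\<bar> < h'"
      then show "norm (G t - c) \<le> q t" using h'0 by (intro \<rho>(2)) auto
    qed
    from second_difference_le[OF m d(1) weak h(1-3) qi q0 this]
    have sd: "norm (d (z - h) + d (z + h) - 2 *\<^sub>R d z - (\<integral>t. tent z h t \<partial>?M) *\<^sub>R c)
        \<le> (\<integral>t. tent z h t * q t \<partial>?M)" .
    \<comment> \<open>Accretivity is used with \<open>l = k / 2\<close>: the vector
      \<open>2 *\<^sub>R d z + k *\<^sub>R c\<close> differs from
      \<open>d (z - h) + d (z + h)\<close> by exactly the quantity estimated in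
      \<open>sd\<close>.\<close>
    define k where "k = (\<integral>t. tent z h t \<partial>?M)"
    have k: "0 \<le> k" unfolding k_def using tent_nonneg by (intro integral_nonneg_AE AE_I2)
    have "2 * norm (d z) \<le> 2 * norm (d z + (k / 2) *\<^sub>R c)" using c[of "k / 2"] k by simp
    also have "\<dots> = norm (2 *\<^sub>R (d z + (k / 2) *\<^sub>R c))" by simp
    also have "2 *\<^sub>R (d z + (k / 2) *\<^sub>R c) = d (z - h) + d (z + h) - (d (z - h) + d (z + h) - 2 *\<^sub>R d z - k *\<^sub>R c)"
      by (simp add: scaleR_add_right)
    also have "norm \<dots> \<le> norm (d (z - h)) + norm (d (z + h)) + (\<integral>t. tent z h t * q t \<partial>?M)"
      using sd[folded k_def] norm_triangle_ineq[of "d (z - h)" "d (z + h)"]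
        norm_triangle_ineq4[of "d (z - h) + d (z + h)" "d (z - h) + d (z + h) - 2 *\<^sub>R d z - k *\<^sub>R c"]
      by linarith
    also have "(\<integral>t. tent z h t * q t \<partial>?M) = T (z - h) + T (z + h) - 2 * T z"
      unfolding T_def using h by (intro potential_second_difference[OF qi, symmetric]) auto
    finally have "2 * Q z \<le> Q (z - h) + Q (z + h)" by (simp add: Q_def)
    then show ?thesis using h by blast
  qed
  \<comment> \<open>One \<open>\<tau>\<close> in the conclusion comes from the potential at 0, the
    other from the potential at \<open>R\<close>.\<close>
  have "Q a \<le> Q 0 + (Q R - Q 0) * (a / R)"
    by (rule midpoint_convex_le_chord[OF cQ R mid a])
  moreover have "(Q R - Q 0) * (a / R) \<le> (norm (d R) + \<tau>) * (a / R)"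
    using T[of R] T[of 0] R a d(2) by (intro mult_right_mono) (auto simp: Q_def)
  moreover have "\<tau> * (a / R) \<le> \<tau>" using a R \<tau> by (intro mult_left_le) auto
  moreover have "Q 0 \<le> \<tau>" using T[of 0] R d(2) by (simp add: Q_def)
  moreover have "norm (d a) \<le> Q a" using T[of a] a by (simp add: Q_def)
  ultimately show ?thesis unfolding distrib_right by linarith
qed

section \<open>Reduction to the difference of two bounded solutions\<close>

text \<open>Eliminates the first derivative \<open>w\<close>: the second weak equation is tested
  with \<open>\<xi>\<close>, the first with \<open>deriv \<xi>\<close>. Each only asserts that some
  common value exists, so uniqueness of the integral of \<open>deriv \<xi>\<close> against
  \<open>w\<close> links them, and the two signs cancel.\<close>

lemma weak_solution_tested:
  fixes u :: "real \<Rightarrow> 'a::banach"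
  assumes "weak_solution m D A f u"
  shows "\<exists>g. locally_integrable (string_measure m) {0..} g \<and>
    (\<forall>\<xi>. test_function \<xi> \<longrightarrow> test_function (deriv \<xi>) \<longrightarrow>
      (\<exists>I. ae_bochner (string_measure m) (\<lambda>t. indicator {0<..} t *\<^sub>R \<xi> t *\<^sub>R g t) I \<and>
          ae_bochner lebesgue (\<lambda>t. indicator {0<..} t *\<^sub>R deriv (deriv \<xi>) t *\<^sub>R u t) I)) \<and>
    (AE z in string_measure m. z \<in> {0<..} \<longrightarrow> u z \<in> D \<and> A (u z) = (1/2) *\<^sub>R g z)"
proof -
  obtain w g where w: "weak_derivative lebesgue u w"
    and g: "locally_integrable (string_measure m) {0..} g" "weak_derivative (string_measure m) w g"
    and ae: "AE z in string_measure m. z \<in> {0<..} \<longrightarrow> u z \<in> D \<and> A (u z) = (1/2) *\<^sub>R g z"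
    using assms unfolding weak_solution_def by blast
  have tested: "\<exists>I. ae_bochner (string_measure m) (\<lambda>t. indicator {0<..} t *\<^sub>R \<xi> t *\<^sub>R g t) I \<and>
          ae_bochner lebesgue (\<lambda>t. indicator {0<..} t *\<^sub>R deriv (deriv \<xi>) t *\<^sub>R u t) I"
    if t: "test_function \<xi>" "test_function (deriv \<xi>)" for \<xi>
  proof -
    obtain I where I: "has_bochner (string_measure m) (\<lambda>z. indicator {0<..} z *\<^sub>R \<xi> z *\<^sub>R g z) I"
      "has_bochner lebesgue (\<lambda>z. indicator {0<..} z *\<^sub>R deriv \<xi> z *\<^sub>R w z) (- I)"
      using g(2) t(1) unfolding weak_derivative_def by blast
    obtain J where J: "has_bochner lebesgue (\<lambda>z. indicator {0<..} z *\<^sub>R deriv \<xi> z *\<^sub>R w z) J"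
      "has_bochner lebesgue (\<lambda>z. indicator {0<..} z *\<^sub>R deriv (deriv \<xi>) z *\<^sub>R u z) (- J)"
      using w t(2) unfolding weak_derivative_def by blast
    have "J = - I" by (rule ae_bochner_unique[OF ae_bochner_if_has_bochner[OF J(1)] ae_bochner_if_has_bochner[OF I(2)]])
    then show ?thesis
      using ae_bochner_if_has_bochner[OF I(1)] ae_bochner_if_has_bochner[OF J(2)] by auto
  qed
  show ?thesis by (intro exI[of _ g] conjI allI impI g(1) ae) (rule tested)
qed

text \<open>A violation at \<open>z\<close> persists on an interval to the right of
  \<open>z\<close>, which lies in the half-line even for \<open>z = 0\<close> and has positive
  length.\<close>

lemma continuous_ess_bounded:
  fixes u :: "real \<Rightarrow> 'a::real_normed_vector"
  assumes u: "continuous_on {0..} u" and ae: "AE z in lebesgue. z \<in> {0..} \<longrightarrow> norm (u z) \<le> C"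
    and z: "0 \<le> z"
  shows "norm (u z) \<le> C"
proof (rule ccontr)
  assume "\<not> norm (u z) \<le> C"
  then have gt: "0 < norm (u z) - C" by simp
  obtain e where e: "0 < e" "\<And>t. t \<in> {0..} \<Longrightarrow> dist t z < e \<Longrightarrow> dist (u t) (u z) < norm (u z) - C"
    using u[unfolded continuous_on_iff, rule_format, of z, OF _ gt] z by auto
  have big: "C < norm (u t)" if "t \<in> {z<..<z + e}" for t
    using e(2)[of t] that z norm_triangle_ineq2[of "u z" "u t"] by (auto simp: dist_norm norm_minus_commute)
  obtain N where N: "N \<in> null_sets lebesgue" "{t. \<not> (t \<in> {0..} \<longrightarrow> norm (u t) \<le> C)} \<subseteq> N"
    using ae by (auto simp: eventually_ae_filter)
  have "{z<..<z + e} \<subseteq> N"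
  proof
    fix t assume t: "t \<in> {z<..<z + e}"
    from big[OF t] t z show "t \<in> N" by (intro subsetD[OF N(2)]) auto
  qed
  then have "emeasure lebesgue {z<..<z + e} \<le> emeasure lebesgue N"
    using N(1) by (intro emeasure_mono) auto
  then show False using N(1) e(1) by (auto simp: null_sets_def)
qed

theorem theorem4p3:
  fixes smul :: "'k::{real_normed_field,real_inner} \<Rightarrow> 'a::banach \<Rightarrow> 'a"
    and m :: "real \<Rightarrow> real" and D :: "'a set" and A :: "'a \<Rightarrow> 'a"
  assumes "banach_space_over smul"
    and "infinite_string m"
    and "linear_operator smul D A"
    and "closed_operator D A"
    and "accretive smul D A"
  shows "\<forall>f. \<forall>u v. weak_solution m D A f u \<and> L_infinity u \<and>
                   weak_solution m D A f v \<and> L_infinity v \<longrightarrow>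
                   (\<forall>z\<ge>0. u z = v z)"
proof (intro allI impI, elim conjE)
  fix f :: 'a and u v :: "real \<Rightarrow> 'a" and a :: real
  assume u: "weak_solution m D A f u" "L_infinity u" and v: "weak_solution m D A f v" "L_infinity v"
    and a: "0 \<le> a"
  let ?M = "string_measure m"
  obtain g where g: "locally_integrable ?M {0..} g"
    "\<forall>\<xi>. test_function \<xi> \<longrightarrow> test_function (deriv \<xi>) \<longrightarrow>
      (\<exists>I. ae_bochner ?M (\<lambda>t. indicator {0<..} t *\<^sub>R \<xi> t *\<^sub>R g t) I \<and>
          ae_bochner lebesgue (\<lambda>t. indicator {0<..} t *\<^sub>R deriv (deriv \<xi>) t *\<^sub>R u t) I)"
    "AE z in ?M. z \<in> {0<..} \<longrightarrow> u z \<in> D \<and> A (u z) = (1/2) *\<^sub>R g z"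
    using weak_solution_tested[OF u(1)] by blast
  obtain g' where g': "locally_integrable ?M {0..} g'"
    "\<forall>\<xi>. test_function \<xi> \<longrightarrow> test_function (deriv \<xi>) \<longrightarrow>
      (\<exists>I. ae_bochner ?M (\<lambda>t. indicator {0<..} t *\<^sub>R \<xi> t *\<^sub>R g' t) I \<and>
          ae_bochner lebesgue (\<lambda>t. indicator {0<..} t *\<^sub>R deriv (deriv \<xi>) t *\<^sub>R v t) I)"
    "AE z in ?M. z \<in> {0<..} \<longrightarrow> v z \<in> D \<and> A (v z) = (1/2) *\<^sub>R g' z"
    using weak_solution_tested[OF v(1)] by blast
  define d where "d z = u z - v z" for z
  define G where "G z = g z - g' z" for z
  have cu: "continuous_on {0..} u" "continuous_on {0..} v" and d0: "d 0 = 0"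
    using u(1) v(1) by (auto simp: weak_solution_def d_def)
  have cd: "continuous_on {0..} d" unfolding d_def by (intro continuous_intros cu)
  have weak: "\<exists>I. ae_bochner ?M (\<lambda>t. indicator {0<..} t *\<^sub>R \<xi> t *\<^sub>R G t) I \<and>
          ae_bochner lebesgue (\<lambda>t. indicator {0<..} t *\<^sub>R deriv (deriv \<xi>) t *\<^sub>R d t) I"
    if t: "test_function \<xi>" "test_function (deriv \<xi>)" for \<xi>
  proof -
    obtain I where I: "ae_bochner ?M (\<lambda>t. indicator {0<..} t *\<^sub>R \<xi> t *\<^sub>R g t) I"
      "ae_bochner lebesgue (\<lambda>t. indicator {0<..} t *\<^sub>R deriv (deriv \<xi>) t *\<^sub>R u t) I"
      using g(2)[rule_format, OF t] by blast
    obtain J where J: "ae_bochner ?M (\<lambda>t. indicator {0<..} t *\<^sub>R \<xi> t *\<^sub>R g' t) J"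
      "ae_bochner lebesgue (\<lambda>t. indicator {0<..} t *\<^sub>R deriv (deriv \<xi>) t *\<^sub>R v t) J"
      using g'(2)[rule_format, OF t] by blast
    from ae_bochner_diff[OF I(1) J(1)] ae_bochner_diff[OF I(2) J(2)] show ?thesis
      unfolding d_def G_def scaleR_diff_right by blast
  qed
  have acc: "AE z in ?M. 0 < z \<longrightarrow> (\<forall>l\<ge>0. norm (d z) \<le> norm (d z + l *\<^sub>R G z))"
    using g(3) g'(3)
  proof eventually_elim
    case (elim z)
    show ?case
    proof (intro impI allI)
      fix l :: real assume z: "0 < z" and l: "0 \<le> l"
      then have e: "u z \<in> D" "v z \<in> D" "A (u z) = (1/2) *\<^sub>R g z" "A (v z) = (1/2) *\<^sub>R g' z"
        using elim by auto
      note dd = linear_operator_diff[OF assms(1,3) e(1,2)]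
      have "A (d z) = (1/2) *\<^sub>R G z"
        unfolding d_def dd(2) e(3,4) G_def by (rule scaleR_diff_right[symmetric])
      \<comment> \<open>The factor 2 compensates
        \<open>A (d z) = (1/2) *\<^sub>R G z\<close>.\<close>
      moreover have "norm (d z) \<le> norm (d z + (2 * l) *\<^sub>R A (d z))"
        using accretive_norm_le[OF assms(5) dd(1), of "2 * l"] l by (simp add: d_def)
      ultimately show "norm (d z) \<le> norm (d z + l *\<^sub>R G z)" by simp
    qed
  qed
  obtain C\<^sub>u C\<^sub>v where "AE z in lebesgue. z \<in> {0..} \<longrightarrow> norm (u z) \<le> C\<^sub>u"
    "AE z in lebesgue. z \<in> {0..} \<longrightarrow> norm (v z) \<le> C\<^sub>v"
    using u(2) v(2) unfolding L_infinity_def by blast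
  from continuous_ess_bounded[OF cu(1) this(1)] continuous_ess_bounded[OF cu(2) this(2)]
  have bd: "norm (d z) \<le> C\<^sub>u + C\<^sub>v" if "0 \<le> z" for z
    using that unfolding d_def by (intro order_trans[OF norm_triangle_ineq4] add_mono) auto
  define C where "C = C\<^sub>u + C\<^sub>v"
  have C: "norm (d z) \<le> C" if "0 \<le> z" for z using bd[OF that] by (simp add: C_def)
  have C0: "0 \<le> C" by (rule order_trans[OF norm_ge_zero C[OF order_refl]])
  have main: "norm (d a) \<le> norm (d R) * (a / R) + 2 * \<tau>" if R: "0 < R" "a \<le> R" and \<tau>: "0 < \<tau>" for R \<tau>
  proof -
    have K: "compact {0..R} \<and> {0..R} \<subseteq> {0..}" by auto
    obtain x y where x: "has_bochner ?M (\<lambda>t. indicator {0..R} t *\<^sub>R g t) x"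
      and y: "has_bochner ?M (\<lambda>t. indicator {0..R} t *\<^sub>R g' t) y"
      using g(1)[unfolded locally_integrable_def, rule_format, OF K]
        g'(1)[unfolded locally_integrable_def, rule_format, OF K] by blast
    have int: "integrable ?M (\<lambda>t. norm (h t))" if h: "has_bochner ?M h x" for h :: "real \<Rightarrow> 'a" and x
    proof (rule integrableI_bounded)
      show "(\<lambda>t. norm (h t)) \<in> borel_measurable ?M"
      proof -
        have "h \<in> borel_measurable ?M" using h unfolding has_bochner_def by (rule conjunct1)
        from borel_measurable_norm_diff_const[OF this, of 0] show ?thesis by simp
      qed
      show "(\<integral>\<^sup>+ t. ennreal (norm (norm (h t))) \<partial>?M) < \<infinity>"
        using has_bochner_nn_integral_finite[OF h] by simp
    qed
    \<comment> \<open>A sum of two norms is used as the bound because each is measurable, whereas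
      \<open>G\<close> is a difference of functions into a possibly non-separable space.\<close>
    define b where "b t = norm (indicator {0..R} t *\<^sub>R g t) + norm (indicator {0..R} t *\<^sub>R g' t)" for t
    have b: "integrable ?M b" "\<And>t. 0 \<le> b t"
      unfolding b_def[abs_def] using int[OF x] int[OF y] by auto
    have bG: "norm (G t) \<le> b t" if "t \<in> {0..R}" for t
      using that norm_triangle_ineq4[of "g t" "g' t"] by (simp add: b_def G_def)
    have G: "ae_bochner ?M (\<lambda>t. indicator {0..R} t *\<^sub>R G t) (x - y)"
      using ae_bochner_diff[OF ae_bochner_if_has_bochner[OF x] ae_bochner_if_has_bochner[OF y]]
      by (simp add: G_def scaleR_diff_right)
    show ?thesis
      by (rule norm_solution_bound[OF assms(2) cd d0 weak G b bG acc R(1) \<tau> a R(2)])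
  qed
  have "norm (d a) \<le> 0"
  proof (rule field_le_epsilon)
    fix \<tau> :: real assume \<tau>: "0 < \<tau>"
    \<comment> \<open>The last term forces \<open>C * (a / R) \<le> \<tau> / 3\<close>, and
      \<open>main\<close> with \<open>\<tau> / 3\<close> adds two more thirds. The summand
      \<open>a + 1\<close> ensures that \<open>R\<close> is positive and at least
      \<open>a\<close>.\<close>
    define R where "R = a + 1 + C * a * 3 / \<tau>"
    have nn: "0 \<le> C * a * 3 / \<tau>" using C0 a \<tau> by simp
    then have R: "0 < R" "a \<le> R" using a by (auto simp: R_def)
    have "norm (d R) * (a / R) \<le> C * (a / R)" using C[of R] R a by (intro mult_right_mono) auto
    also have "\<dots> \<le> \<tau> / 3"
    proof -
      have "C * a * 3 / \<tau> \<le> R" using a by (simp add: R_def)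
      then show ?thesis using R \<tau> by (simp add: field_simps)
    qed
    finally have small: "norm (d R) * (a / R) \<le> \<tau> / 3" .
    have "0 < \<tau> / 3" using \<tau> by simp
    from main[OF R this] small show "norm (d a) \<le> 0 + \<tau>" by linarith
  qed
  then show "u a = v a" by (simp add: d_def)
qed

end
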